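(* Let $d\ge 1$. For every $d$-dimensional Dirac operator $(D,R)$ there is a commuting $d$-tuple $\bar T=(T_1,\dots,T_d)$ of bounded operators acting on a Hilbert space $H$ such that $(D,R)$ is isomorphic to the Dirac operator $D_{\bar T}$ associated with $\bar T$. Moreover, if $\bar T=(T_1,\dots,T_d)$ is a commuting $d$-tuple of bounded operators on a Hilbert space $H$ and $\bar T'=(T_1',\dots,T_d')$ is another commuting $d$-tuple of bounded operators acting on a Hilbert space $H'$, then $D_{\bar T}$ and $D_{\bar T'}$ are isomorphic if and only if there is a unitary operator $U:H\to H'$ such that $UT_k=T_k'U$ for every $k=1,\dots,d$.
   Context: All Hilbert spaces are complex, $\mathcal B(K)$ denotes the bounded operators on $K$, $\mathbb T$ is the unit circle, and $e_1,\dots,e_d$ is the standard basis of $\mathbb C^d$. Clifford structure: a real-linear map $R:\mathbb C^d\to\mathcal B(K)$ whose values are self-adjoint operators and which satisfies $R(z)^2=\|z\|^2\mathbf 1$ for $z\in\mathbb C^d$ (Euclidean norm). Put $C(z)=\frac12(R(z)-iR(iz))$; then $C$ is complex-linear, $R(z)=C(z)+C(z)^*$, and $C(z)C(w)+C(w)C(z)=0$, $C(w)^*C(z)+C(z)C(w)^*=\langle z,w\rangle\mathbf 1$. Gauge group of $R$: the unitary representation $\Gamma$ of $\mathbb T$ on $K$ given by $\Gamma(e^{it})=e^{itN}$, $t\in\mathbb R$, where $N=\sum_{k=1}^d C(e_k)C(e_k)^*$ (a self-adjoint operator with spectrum in $\{0,1,\dots,d\}$). It satisfies $\Gamma(\lambda)R(z)\Gamma(\lambda)^*=R(\lambda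 z)$. Dirac operator of dimension $d$: a pair $(D,R)$ where $D$ is a bounded self-adjoint operator on a Hilbert space $K$ and $R:\mathbb C^d\to\mathcal B(K)$ is a Clifford structure such that (D1) $\Gamma(-1)D\Gamma(-1)^*=-D$; (D2) $\Gamma(\lambda)D^2\Gamma(\lambda)^*=D^2$ for all $\lambda\in\mathbb T$; (D3) $R(z)D+DR(z)\in\mathcal A'$ for all $z\in\mathbb C^d$, where $\mathcal A$ is the $C^*$-algebra generated by $R(\mathbb C^d)$, $\mathcal A'$ is its commutant, and $\Gamma$ is the gauge group of $R$. Isomorphism: $(D,R)$ on $K$ and $(D',R')$ on $K'$ are isomorphic if there is a unitary $W:K\to K'$ with $WD=D'W$ and $WR(z)=R'(z)W$ for all $z\in\mathbb C^d$. Dirac operator $D_{\bar T}$ of a commuting $d$-tuple $\bar T$ on $H$: let $\Lambda\mathbb C^d$ be the exterior algebra with its natural inner product ($\langle z_1\wedge\dots\wedge z_k,w_1\wedge\dots\wedge w_k\rangle=\det(\langle z_i,w_j\rangle)$, different degrees orthogonal), and let $C_0(z)\in\mathcal B(\Lambda\mathbb C^d)$ be the creation operator $C_0(z)x=z\wedge x$. On $\tilde H=H\otimes\Lambda\mathbb C^d$ set $B=\sum_{k=1}^d T_k\otimes C_0(e_k)$, $D=B+B^*$, and $R(z)=\mathbf 1_H\otimes(C_0(z)+C_0(z)^* )$. Then $D_{\bar T}$ denotes the pair $(D,R)$, which is a Dirac operator of dimension $d$. *)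

theory Defs
  imports "HOL-Analysis.Analysis"
begin

section \<open>Complex Hilbert spaces\<close>

text \<open>
  Inner products are linear in the first argument. The underlying real inner product, norm and
  topology are those of the real part, so that the notions of the library are available.
\<close>

class complex_inner = real_inner +
  fixes scaleC :: "complex \<Rightarrow> 'a \<Rightarrow> 'a"  (infixr \<open>*\<^sub>C\<close> 75)
    and cinner :: "'a \<Rightarrow> 'a \<Rightarrow> complex"
  assumes scaleC_add_right: "a *\<^sub>C (x + y) = a *\<^sub>C x + a *\<^sub>C y"
    and scaleC_add_left: "(a + b) *\<^sub>C x = a *\<^sub>C x + b *\<^sub>C x"
    and scaleC_scaleC: "a *\<^sub>C b *\<^sub>C x = (a * b) *\<^sub>C x"
    and scaleC_one: "1 *\<^sub>C x = x"
    and scaleR_scaleC: "r *\<^sub>R x = complex_of_real r *\<^sub>C x"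
    and cinner_commute: "cinner x y = cnj (cinner y x)"
    and cinner_add_left: "cinner (x + y) z = cinner x z + cinner y z"
    and cinner_scaleC_left: "cinner (a *\<^sub>C x) y = a * cinner x y"
    and inner_eq_Re_cinner: "inner x y = Re (cinner x y)"

instantiation complex :: complex_inner
begin

definition scaleC_complex :: "complex \<Rightarrow> complex \<Rightarrow> complex"
  where "scaleC_complex a z = a * z"

definition cinner_complex :: "complex \<Rightarrow> complex \<Rightarrow> complex"
  where "cinner_complex z w = z * cnj w"

instance
  by standard
    (auto simp: scaleC_complex_def cinner_complex_def inner_complex_def algebra_simps
      scaleR_conv_of_real)

end

instantiation vec :: (complex_inner, finite) complex_inner
begin

definition scaleC_vec :: "complex \<Rightarrow> ('a, 'b) vec \<Rightarrow> ('a, 'b) vec"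
  where "scaleC_vec a x = (\<chi> i. a *\<^sub>C (x $ i))"

definition cinner_vec :: "('a, 'b) vec \<Rightarrow> ('a, 'b) vec \<Rightarrow> complex"
  where "cinner_vec x y = (\<Sum>i\<in>UNIV. cinner (x $ i) (y $ i))"

instance
proof
  fix x y :: "('a, 'b) vec"
  show "cinner x y = cnj (cinner y x)"
    unfolding cinner_vec_def by (simp flip: cinner_commute)
qed (auto simp: scaleC_vec_def cinner_vec_def vec_eq_iff scaleC_add_right scaleC_add_left
    scaleC_scaleC scaleC_one scaleR_scaleC cinner_add_left cinner_scaleC_left sum.distrib
    sum_distrib_left inner_vec_def inner_eq_Re_cinner)

end

text \<open>
  A Hilbert space is a complete complex-linear subspace of a type of class
  \<^class>\<open>complex_inner\<close>. Working with carriers makes it possible to quantify over Hilbert spaces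
  within a formula. Operators on \<open>K\<close> are functions of which only the values on \<open>K\<close> matter.
\<close>

definition hilbert_space :: "'a::complex_inner set \<Rightarrow> bool"
  where "hilbert_space K \<longleftrightarrow>
    0 \<in> K \<and> (\<forall>x\<in>K. \<forall>y\<in>K. x + y \<in> K) \<and> (\<forall>a. \<forall>x\<in>K. a *\<^sub>C x \<in> K) \<and> complete K"

definition clinear_on :: "'a::complex_inner set \<Rightarrow> ('a \<Rightarrow> 'b::complex_inner) \<Rightarrow> bool"
  where "clinear_on K X \<longleftrightarrow>
    (\<forall>x\<in>K. \<forall>y\<in>K. X (x + y) = X x + X y) \<and> (\<forall>a. \<forall>x\<in>K. X (a *\<^sub>C x) = a *\<^sub>C X x)"

definition bounded_ops :: "'a::complex_inner set \<Rightarrow> ('a \<Rightarrow> 'a) set"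
  where "bounded_ops K =
    {X. (\<forall>x\<in>K. X x \<in> K) \<and> clinear_on K X \<and> (\<exists>M. \<forall>x\<in>K. norm (X x) \<le> M * norm x)}"

definition adjoint_on :: "'a::complex_inner set \<Rightarrow> ('a \<Rightarrow> 'a) \<Rightarrow> 'a \<Rightarrow> 'a"
  where "adjoint_on K X y = (THE v. v \<in> K \<and> (\<forall>x\<in>K. cinner (X x) y = cinner x v))"

definition self_adjoint_on :: "'a::complex_inner set \<Rightarrow> ('a \<Rightarrow> 'a) \<Rightarrow> bool"
  where "self_adjoint_on K X \<longleftrightarrow> X \<in> bounded_ops K \<and> (\<forall>x\<in>K. adjoint_on K X x = X x)"

definition unitary_on ::
  "'a::complex_inner set \<Rightarrow> 'b::complex_inner set \<Rightarrow> ('a \<Rightarrow> 'b) \<Rightarrow> bool"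
  where "unitary_on K K' W \<longleftrightarrow>
    clinear_on K W \<and> bij_betw W K K' \<and> (\<forall>x\<in>K. \<forall>y\<in>K. cinner (W x) (W y) = cinner x y)"

text \<open>For a bounded operator the exponential series also converges in norm.\<close>

definition exp_op :: "('a::complex_inner \<Rightarrow> 'a) \<Rightarrow> 'a \<Rightarrow> 'a"
  where "exp_op X x = (\<Sum>n. (1 / fact n) *\<^sub>R (X ^^ n) x)"


section \<open>Generated C*-algebras and commutants\<close>

text \<open>
  The last condition is closedness in the operator norm; it also makes \<open>\<A>\<close> invariant under
  changing the values of its elements outside of \<open>K\<close>.
\<close>

definition cstar_subalgebra :: "'a::complex_inner set \<Rightarrow> ('a \<Rightarrow> 'a) set \<Rightarrow> bool"
  where "cstar_subalgebra K \<A> \<longleftrightarrow>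
    \<A> \<subseteq> bounded_ops K \<and>
    (\<lambda>x. 0) \<in> \<A> \<and>
    (\<forall>X\<in>\<A>. \<forall>Y\<in>\<A>. (\<lambda>x. X x + Y x) \<in> \<A>) \<and>
    (\<forall>a. \<forall>X\<in>\<A>. (\<lambda>x. a *\<^sub>C X x) \<in> \<A>) \<and>
    (\<forall>X\<in>\<A>. \<forall>Y\<in>\<A>. (\<lambda>x. X (Y x)) \<in> \<A>) \<and>
    (\<forall>X\<in>\<A>. adjoint_on K X \<in> \<A>) \<and>
    (\<forall>X\<in>bounded_ops K.
      (\<forall>\<epsilon>>0. \<exists>Y\<in>\<A>. \<forall>x\<in>K. norm (X x - Y x) \<le> \<epsilon> * norm x) \<longrightarrow> X \<in> \<A>)"

definition cstar_generated :: "'a::complex_inner set \<Rightarrow> ('a \<Rightarrow> 'a) set \<Rightarrow> ('a \<Rightarrow> 'a) set"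
  where "cstar_generated K S = \<Inter>{\<A>. cstar_subalgebra K \<A> \<and> S \<subseteq> \<A>}"

definition commutant :: "'a::complex_inner set \<Rightarrow> ('a \<Rightarrow> 'a) set \<Rightarrow> ('a \<Rightarrow> 'a) set"
  where "commutant K \<A> = {X \<in> bounded_ops K. \<forall>Y\<in>\<A>. \<forall>x\<in>K. X (Y x) = Y (X x)}"


section \<open>Clifford structures and Dirac operators\<close>

text \<open>
  The space of complex \<open>d\<close>-tuples is \<^typ>\<open>complex^'d\<close>, where \<open>d = CARD('d) \<ge> 1\<close>, with its standard
  basis \<^term>\<open>axis k 1\<close>; its norm in the library is the Euclidean one.
\<close>

definition clifford_structure ::
  "'a::complex_inner set \<Rightarrow> (complex^'d::finite \<Rightarrow> 'a \<Rightarrow> 'a) \<Rightarrow> bool"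
  where "clifford_structure K R \<longleftrightarrow>
    (\<forall>z. self_adjoint_on K (R z)) \<and>
    (\<forall>z w. \<forall>x\<in>K. R (z + w) x = R z x + R w x) \<and>
    (\<forall>r z. \<forall>x\<in>K. R (r *\<^sub>R z) x = r *\<^sub>R R z x) \<and>
    (\<forall>z. \<forall>x\<in>K. R z (R z x) = (norm z)\<^sup>2 *\<^sub>R x)"

definition creation_part ::
  "(complex^'d::finite \<Rightarrow> 'a::complex_inner \<Rightarrow> 'a) \<Rightarrow> complex^'d \<Rightarrow> 'a \<Rightarrow> 'a"
  where "creation_part R z x = (1/2) *\<^sub>C (R z x - \<i> *\<^sub>C R (\<i> *s z) x)"

definition number_op ::
  "'a::complex_inner set \<Rightarrow> (complex^'d::finite \<Rightarrow> 'a \<Rightarrow> 'a) \<Rightarrow> 'a \<Rightarrow> 'a"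
  where "number_op K R x =
    (\<Sum>k\<in>UNIV. creation_part R (axis k 1) (adjoint_on K (creation_part R (axis k 1)) x))"

text \<open>
  The spectrum of the number operator \<open>N\<close> consists of integers, so that \<open>exp (\<i> t N)\<close> only depends
  on \<open>exp (\<i> t)\<close>, and the choice \<open>t = Arg u\<close> is immaterial.
\<close>

definition gauge_group ::
  "'a::complex_inner set \<Rightarrow> (complex^'d::finite \<Rightarrow> 'a \<Rightarrow> 'a) \<Rightarrow> complex \<Rightarrow> 'a \<Rightarrow> 'a"
  where "gauge_group K R u = exp_op (\<lambda>x. (\<i> * complex_of_real (Arg u)) *\<^sub>C number_op K R x)"

type_synonym ('a, 'd) dirac_pair = "('a \<Rightarrow> 'a) \<times> (complex^'d \<Rightarrow> 'a \<Rightarrow> 'a)"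

definition dirac_operator :: "'a::complex_inner set \<Rightarrow> ('a, 'd::finite) dirac_pair \<Rightarrow> bool"
  where "dirac_operator K = (\<lambda>(D, R).
    hilbert_space K \<and> self_adjoint_on K D \<and> clifford_structure K R \<and>
    (\<forall>x\<in>K. gauge_group K R (-1) (D (adjoint_on K (gauge_group K R (-1)) x)) = - D x) \<and>
    (\<forall>u. norm u = 1 \<longrightarrow>
      (\<forall>x\<in>K. gauge_group K R u (D (D (adjoint_on K (gauge_group K R u) x))) = D (D x))) \<and>
    (\<forall>z. (\<lambda>x. R z (D x) + D (R z x)) \<in> commutant K (cstar_generated K (range R))))"

definition dirac_isomorphic ::
  "'a::complex_inner set \<Rightarrow> ('a, 'd::finite) dirac_pair \<Rightarrow>
    'b::complex_inner set \<Rightarrow> ('b, 'd) dirac_pair \<Rightarrow> bool"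
  where "dirac_isomorphic K = (\<lambda>(D, R) K' (D', R').
    \<exists>W. unitary_on K K' W \<and>
      (\<forall>x\<in>K. W (D x) = D' (W x)) \<and> (\<forall>z. \<forall>x\<in>K. W (R z x) = R' z (W x)))"


section \<open>The exterior algebra\<close>

text \<open>
  The exterior algebra over \<^typ>\<open>complex^'d\<close> is \<^typ>\<open>complex^('d set)\<close>. The basis vector
  \<^term>\<open>axis S 1\<close> stands for \<open>e\<^bsub>s\<^sub>1\<^esub> \<and> \<dots> \<and> e\<^bsub>s\<^sub>k\<^esub>\<close> where \<open>s\<^sub>1 < \<dots> < s\<^sub>k\<close> are the elements of
  \<open>S\<close>. The product of the basis vectors of two disjoint sets is that of their union up to the
  parity of the number of inversions.
\<close>

definition wedge ::
  "complex^('d::{finite,linorder} set) \<Rightarrow> complex^('d set) \<Rightarrow> complex^('d set)"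
  where "wedge x y =
    (\<chi> U. \<Sum>S\<in>Pow U. (-1) ^ card {(s, t). s \<in> S \<and> t \<in> U - S \<and> t < s} * (x $ S) * (y $ (U - S)))"

definition ext_vector :: "complex^'d::{finite,linorder} \<Rightarrow> complex^('d set)"
  where "ext_vector z = (\<Sum>k\<in>UNIV. z $ k *s axis {k} 1)"

definition creation_op ::
  "complex^'d::{finite,linorder} \<Rightarrow> complex^('d set) \<Rightarrow> complex^('d set)"
  where "creation_op z x = wedge (ext_vector z) x"

definition wedge_list :: "(complex^'d::{finite,linorder}) list \<Rightarrow> complex^('d set)"
  where "wedge_list zs = foldr creation_op zs (axis {} 1)"

definition ext_sign :: "'d::linorder set \<Rightarrow> 'd \<Rightarrow> complex"
  where "ext_sign S k = (-1) ^ card {t\<in>S. t < k}"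

lemma creation_op_nth:
  fixes z :: "complex^'d::{finite,linorder}"
  shows "creation_op z x $ U =
    (\<Sum>k\<in>UNIV. if k \<in> U then ext_sign U k * z $ k * x $ (U - {k}) else 0)"
proof -
  have e: "ext_vector z $ S = (\<Sum>k\<in>UNIV. if S = {k} then z $ k else 0)" for S
    by (auto simp: ext_vector_def axis_def intro!: sum.cong)
  have "creation_op z x $ U = (\<Sum>S\<in>Pow U. \<Sum>k\<in>UNIV. if S = {k} then
      (-1) ^ card {(s, t). s \<in> S \<and> t \<in> U - S \<and> t < s} * z $ k * x $ (U - S) else 0)"
    unfolding creation_op_def wedge_def
    by (auto simp: e sum_distrib_left sum_distrib_right intro!: sum.cong)
  also have "\<dots> = (\<Sum>k\<in>UNIV. \<Sum>S\<in>Pow U. if S = {k} then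
      (-1) ^ card {(s, t). s \<in> S \<and> t \<in> U - S \<and> t < s} * z $ k * x $ (U - S) else 0)"
    by (rule sum.swap)
  also have "\<dots> = (\<Sum>k\<in>UNIV. if k \<in> U then ext_sign U k * z $ k * x $ (U - {k}) else 0)"
  proof (intro sum.cong refl)
    fix k
    have "{(s, t). s \<in> {k} \<and> t \<in> U - {k} \<and> t < s} = Pair k ` {t\<in>U. t < k}"
      by auto
    then have "card {(s, t). s \<in> {k} \<and> t \<in> U - {k} \<and> t < s} = card {t\<in>U. t < k}"
      by (simp add: card_image inj_on_def)
    then show "(\<Sum>S\<in>Pow U. if S = {k} then
      (-1) ^ card {(s, t). s \<in> S \<and> t \<in> U - S \<and> t < s} * z $ k * x $ (U - S) else 0) =
      (if k \<in> U then ext_sign U k * z $ k * x $ (U - {k}) else 0)"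
      by (simp add: ext_sign_def)
  qed
  finally show ?thesis .
qed

lemma ext_sign_remove: "ext_sign (U - {k}) l = (if k \<in> U \<and> k < l then - ext_sign U l else ext_sign U l)"
  for U :: "'d::{finite,linorder} set"
proof (cases "k \<in> U \<and> k < l")
  case True
  then have "{t\<in>U. t < l} = insert k {t\<in>U - {k}. t < l}" by auto
  then show ?thesis using True by (simp add: ext_sign_def)
next
  case False
  then have "{t\<in>U - {k}. t < l} = {t\<in>U. t < l}" by auto
  then show ?thesis using False by (auto simp: ext_sign_def)
qed

lemma ext_sign_insert: "ext_sign (insert k U) l = (if k \<notin> U \<and> k < l then - ext_sign U l else ext_sign U l)"
  for U :: "'d::{finite,linorder} set"
  using ext_sign_remove[of "insert k U" k l] by (cases "k \<in> U") (auto simp: insert_absorb)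

lemma ext_sign_square: "ext_sign U k * ext_sign U k = 1"
  by (simp add: ext_sign_def flip: power_add mult_2)

lemma creation_op_anticommute:
  "creation_op z (creation_op w x) = - creation_op w (creation_op z x)"
proof (simp add: vec_eq_iff, intro allI)
  fix U
  have expand: "creation_op z (creation_op w x) $ U = (\<Sum>k\<in>UNIV. \<Sum>l\<in>UNIV.
     if k \<in> U \<and> l \<in> U \<and> k \<noteq> l then ext_sign U k * ext_sign (U - {k}) l * z $ k * w $ l * x $ (U - {k} - {l})
     else 0)" for z w
    by (auto simp: creation_op_nth sum_distrib_left intro!: sum.cong)
  show "creation_op z (creation_op w x) $ U = - creation_op w (creation_op z x) $ U"
    unfolding expand
    apply (subst sum.swap)
    unfolding sum_negf[symmetric]
    apply (intro sum.cong refl)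
    by (auto simp: ext_sign_remove Diff_insert2[symmetric] insert_commute)
qed

definition annihilation_op ::
  "complex^'d::{finite,linorder} \<Rightarrow> complex^('d set) \<Rightarrow> complex^('d set)"
  where "annihilation_op z y =
    (\<chi> S. \<Sum>k\<in>UNIV. if k \<in> S then 0 else ext_sign S k * cnj (z $ k) * y $ (insert k S))"

lemma cinner_creation_op:
  fixes z :: "complex^'d::{finite,linorder}"
  shows "cinner (creation_op z x) y = cinner x (annihilation_op z y)"
proof -
  have "cinner (creation_op z x) y = (\<Sum>U\<in>UNIV. \<Sum>k\<in>UNIV.
      if k \<in> U then ext_sign U k * z $ k * x $ (U - {k}) * cnj (y $ U) else 0)"
    by (auto simp: cinner_vec_def cinner_complex_def creation_op_nth sum_distrib_right
        intro!: sum.cong)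
  also have "\<dots> = (\<Sum>k\<in>UNIV. \<Sum>U\<in>UNIV.
      if k \<in> U then ext_sign U k * z $ k * x $ (U - {k}) * cnj (y $ U) else 0)"
    by (rule sum.swap)
  also have "\<dots> = (\<Sum>k\<in>UNIV. \<Sum>S\<in>UNIV.
      if k \<in> S then 0 else ext_sign S k * z $ k * x $ S * cnj (y $ insert k S))"
  proof (rule sum.cong[OF refl])
    fix k :: 'd
    have "(\<Sum>U\<in>UNIV. if k \<in> U then ext_sign U k * z $ k * x $ (U - {k}) * cnj (y $ U) else 0) =
      (\<Sum>U\<in>{U. k \<in> U}. ext_sign U k * z $ k * x $ (U - {k}) * cnj (y $ U))"
      by (simp add: sum.If_cases)
    also have "\<dots> = (\<Sum>S\<in>{S. k \<notin> S}. ext_sign S k * z $ k * x $ S * cnj (y $ insert k S))"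
      by (rule sum.reindex_bij_witness[of _ "insert k" "\<lambda>U. U - {k}"])
        (auto simp: ext_sign_remove insert_absorb)
    also have "\<dots> = (\<Sum>S\<in>UNIV. if k \<in> S then 0 else ext_sign S k * z $ k * x $ S * cnj (y $ insert k S))"
      by (simp add: sum.If_cases Compl_eq)
    finally show "(\<Sum>U\<in>UNIV. if k \<in> U then ext_sign U k * z $ k * x $ (U - {k}) * cnj (y $ U) else 0) =
      (\<Sum>S\<in>UNIV. if k \<in> S then 0 else ext_sign S k * z $ k * x $ S * cnj (y $ insert k S))" .
  qed
  also have "\<dots> = (\<Sum>S\<in>UNIV. \<Sum>k\<in>UNIV.
      if k \<in> S then 0 else ext_sign S k * z $ k * x $ S * cnj (y $ insert k S))"
    by (rule sum.swap)
  also have "\<dots> = cinner x (annihilation_op z y)"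
    by (auto simp: cinner_vec_def cinner_complex_def annihilation_op_def sum_distrib_left ext_sign_def
        intro!: sum.cong)
  finally show ?thesis .
qed

lemma adjoint_creation_op: "adjoint_on UNIV (creation_op z) = annihilation_op z"
proof
  fix y
  have "v = annihilation_op z y" if "\<forall>x. cinner (creation_op z x) y = cinner x v" for v
  proof -
    have axis: "cinner (axis S 1) u = cnj (u $ S)" for S and u :: "complex^('a set)"
      by (simp add: cinner_vec_def cinner_complex_def axis_def mult_delta_left)
    from that have "cinner (axis S 1) v = cinner (axis S 1) (annihilation_op z y)" for S
      by (metis cinner_creation_op)
    then show ?thesis
      unfolding axis by (simp add: vec_eq_iff)
  qed
  then show "adjoint_on UNIV (creation_op z) y = annihilation_op z y"
    unfolding adjoint_on_def by (intro the_equality) (auto simp: cinner_creation_op)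
qed

lemma annihilation_creation:
  "annihilation_op z (creation_op w x) = cinner w z *s x - creation_op w (annihilation_op z x)"
proof (simp add: vec_eq_iff, intro allI)
  fix S
  let ?g = "\<lambda>k l. ext_sign S k * ext_sign (insert k S) l * cnj (z $ k) * w $ l * x $ (insert k S - {l})"
  have "annihilation_op z (creation_op w x) $ S =
      (\<Sum>k\<in>UNIV. \<Sum>l\<in>UNIV. (if k \<notin> S \<and> l = k then ?g k l else 0) +
         (if k \<notin> S \<and> l \<in> S then ?g k l else 0))"
    by (auto simp: annihilation_op_def creation_op_nth sum_distrib_left mult_ac intro!: sum.cong)
  also have "\<dots> = (\<Sum>k\<in>UNIV. if k \<notin> S then cnj (z $ k) * w $ k * x $ S else 0) +
      (\<Sum>k\<in>UNIV. \<Sum>l\<in>UNIV. if k \<notin> S \<and> l \<in> S then ?g k l else 0)" (is "_ = ?A + ?B")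
    unfolding sum.distrib
    by (auto intro!: sum.cong simp: ext_sign_insert ext_sign_square)
  finally have 1: "annihilation_op z (creation_op w x) $ S = ?A + ?B" .
  let ?h = "\<lambda>l k. ext_sign S l * ext_sign (S - {l}) k * cnj (z $ k) * w $ l * x $ (insert k (S - {l}))"
  have "creation_op w (annihilation_op z x) $ S =
      (\<Sum>l\<in>UNIV. \<Sum>k\<in>UNIV. (if l \<in> S \<and> k = l then ?h l k else 0) +
         (if k \<notin> S \<and> l \<in> S then ?h l k else 0))"
    by (auto simp: annihilation_op_def creation_op_nth sum_distrib_left mult_ac intro!: sum.cong)
  also have "\<dots> = (\<Sum>l\<in>UNIV. if l \<in> S then cnj (z $ l) * w $ l * x $ S else 0) +
      (\<Sum>l\<in>UNIV. \<Sum>k\<in>UNIV. if k \<notin> S \<and> l \<in> S then ?h l k else 0)" (is "_ = ?C + ?E")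
    unfolding sum.distrib
    by (auto intro!: sum.cong simp: ext_sign_remove ext_sign_square insert_absorb)
  finally have 2: "creation_op w (annihilation_op z x) $ S = ?C + ?E" .
  have "?B = - ?E"
    apply (subst sum.swap)
    unfolding sum_negf[symmetric]
    apply (intro sum.cong refl)
    by (auto simp: ext_sign_remove ext_sign_insert insert_Diff_if)
  moreover have "?A + ?C = cinner w z * x $ S"
    unfolding sum.distrib[symmetric] cinner_vec_def sum_distrib_right
    by (auto simp: cinner_complex_def intro!: sum.cong)
  ultimately show "annihilation_op z (creation_op w x) $ S =
      cinner w z * x $ S - creation_op w (annihilation_op z x) $ S"
    unfolding 1 2 by (simp add: algebra_simps)
qed


lemma creation_op_linear:
  "creation_op z (a *s x) = a *s creation_op z x"
  "creation_op z (x + y) = creation_op z x + creation_op z y"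
  "creation_op z (- x) = - creation_op z x"
  "creation_op z 0 = 0"
  by (auto simp: creation_op_def wedge_def vec_eq_iff sum_distrib_left sum.distrib
      algebra_simps sum_negf)

lemma creation_op_sum: "creation_op z (\<Sum>i\<in>A. f i) = (\<Sum>i\<in>A. creation_op z (f i))"
  by (induction A rule: infinite_finite_induct) (auto simp: creation_op_linear)

lemma annihilation_op_unit: "annihilation_op z (axis {} 1) = 0"
  by (simp add: annihilation_op_def vec_eq_iff axis_def) (auto intro!: sum.neutral)

definition wedge_range :: "(nat \<Rightarrow> complex^'d::{finite,linorder}) \<Rightarrow> nat \<Rightarrow> nat \<Rightarrow> complex^('d set)"
  where "wedge_range f m n = wedge_list (map f [m..<n])"

lemma wedge_range_Suc: "m < n \<Longrightarrow> wedge_range f m n = creation_op (f m) (wedge_range f (Suc m) n)"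
  by (simp add: wedge_range_def wedge_list_def upt_conv_Cons)

lemma wedge_range_empty: "n \<le> m \<Longrightarrow> wedge_range f m n = axis {} 1"
  by (simp add: wedge_range_def wedge_list_def)

lemma wedge_range_cong: "(\<And>i. m \<le> i \<Longrightarrow> i < n \<Longrightarrow> f i = g i) \<Longrightarrow> wedge_range f m n = wedge_range g m n"
  unfolding wedge_range_def by (rule arg_cong[where f = wedge_list]) auto

lemma creation_wedge_range_swap:
  "m \<le> b \<Longrightarrow> b < n \<Longrightarrow>
    creation_op u (wedge_range (f(b := v)) m n) = - creation_op v (wedge_range (f(b := u)) m n)"
proof (induction "n - m" arbitrary: m)
  case 0
  then show ?case by simp
next
  case (Suc j)
  show ?case
  proof (cases "b = m")
    case True
    have "wedge_range (f(m := u)) (Suc m) n = wedge_range f (Suc m) n" for u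
      by (rule wedge_range_cong) simp
    then show ?thesis
      using True Suc.prems by (simp add: wedge_range_Suc creation_op_anticommute[of u v])
  next
    case False
    then have "creation_op u (wedge_range (f(b := v)) (Suc m) n) =
        - creation_op v (wedge_range (f(b := u)) (Suc m) n)"
      using Suc by auto
    then show ?thesis
      using False Suc.prems
      by (simp add: wedge_range_Suc creation_op_anticommute[of _ "f m"] creation_op_linear)
  qed
qed

lemma annihilation_wedge_range:
  "m \<le> n \<Longrightarrow> annihilation_op z (wedge_range w m n) =
    (\<Sum>b\<in>{m..<n}. ((if b = m then 1 else -1) * cinner (w b) z) *s
        wedge_range (w \<circ> Transposition.transpose m b) (Suc m) n)"
proof (induction "n - m" arbitrary: m)
  case 0
  then show ?case by (simp add: wedge_range_empty annihilation_op_unit)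
next
  case (Suc j)
  then have m: "m < n" by simp
  have swap: "creation_op (w m) (wedge_range (w \<circ> Transposition.transpose (Suc m) b) (Suc (Suc m)) n) =
      (if b = Suc m then 1 else -1) *s wedge_range (w \<circ> Transposition.transpose m b) (Suc m) n"
    if b: "Suc m \<le> b" "b < n" for b
  proof (cases "b = Suc m")
    case True
    have "wedge_range (w \<circ> Transposition.transpose m (Suc m)) (Suc (Suc m)) n = wedge_range w (Suc (Suc m)) n"
      by (rule wedge_range_cong) (simp add: Transposition.transpose_def)
    with True b show ?thesis
      by (simp add: wedge_range_Suc)
  next
    case False
    have "creation_op (w m) (wedge_range (w \<circ> Transposition.transpose (Suc m) b) (Suc (Suc m)) n) =
       creation_op (w m) (wedge_range (w(b := w (Suc m))) (Suc (Suc m)) n)"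
      by (rule arg_cong[where f = "creation_op _"], rule wedge_range_cong)
        (auto simp: Transposition.transpose_def)
    also have "\<dots> = - creation_op (w (Suc m)) (wedge_range (w(b := w m)) (Suc (Suc m)) n)"
      by (rule creation_wedge_range_swap) (use b False in auto)
    also have "creation_op (w (Suc m)) (wedge_range (w(b := w m)) (Suc (Suc m)) n) =
        wedge_range (w(b := w m)) (Suc m) n"
      using b False by (simp add: wedge_range_Suc)
    also have "\<dots> = wedge_range (w \<circ> Transposition.transpose m b) (Suc m) n"
      by (rule wedge_range_cong) (auto simp: Transposition.transpose_def)
    finally show ?thesis
      using False by (simp add: vec_eq_iff comp_def)
  qed
  have "annihilation_op z (wedge_range w m n) =
      cinner (w m) z *s wedge_range w (Suc m) n -
      creation_op (w m) (annihilation_op z (wedge_range w (Suc m) n))"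
    using m by (simp add: wedge_range_Suc annihilation_creation)
  also have "creation_op (w m) (annihilation_op z (wedge_range w (Suc m) n)) =
      (\<Sum>b\<in>{Suc m..<n}. cinner (w b) z *s wedge_range (w \<circ> Transposition.transpose m b) (Suc m) n)"
  proof -
    have IH: "annihilation_op z (wedge_range w (Suc m) n) =
      (\<Sum>b\<in>{Suc m..<n}. ((if b = Suc m then 1 else -1) * cinner (w b) z) *s
        wedge_range (w \<circ> Transposition.transpose (Suc m) b) (Suc (Suc m)) n)"
      using Suc.hyps(2) m by (intro Suc.hyps(1)) auto
    show ?thesis
      unfolding IH creation_op_sum creation_op_linear
      by (rule sum.cong[OF refl]) (subst swap, auto)
  qed
  also have "cinner (w m) z *s wedge_range w (Suc m) n - \<dots> =
    (\<Sum>b\<in>{m..<n}. ((if b = m then 1 else -1) * cinner (w b) z) *s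
        wedge_range (w \<circ> Transposition.transpose m b) (Suc m) n)"
    using m by (subst (2) sum.atLeast_Suc_lessThan) (auto simp: vec_eq_iff simp flip: sum_negf)
  finally show ?case .
qed

lemma cinner_wedge_range:
  "m \<le> n \<Longrightarrow> cinner (wedge_range z m n) (wedge_range w m n) =
    (\<Sum>p | p permutes {m..<n}. of_int (sign p) * (\<Prod>i\<in>{m..<n}. cinner (z i) (w (p i))))"
proof (induction "n - m" arbitrary: m w)
  case 0
  then show ?case
    by (simp add: wedge_range_empty cinner_vec_def cinner_complex_def axis_def mult_delta_left)
next
  case (Suc j)
  then have m: "m < n" by simp
  then have I: "{m..<n} = insert m {Suc m..<n}" by auto
  have right: "cinner y (a *s x) = cnj a * cinner y x" for a and x y :: "complex^('a set)"
    by (simp add: cinner_vec_def cinner_complex_def sum_distrib_left mult_ac)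
  have right_sum: "cinner y (\<Sum>i\<in>A. f i) = (\<Sum>i\<in>A. cinner y (f i))"
    for A :: "nat set" and f and y :: "complex^('a set)"
    by (simp add: cinner_vec_def cinner_complex_def sum_distrib_left)
      (rule sum.swap)
  have "cinner (wedge_range z m n) (wedge_range w m n) =
      cinner (wedge_range z (Suc m) n) (annihilation_op (z m) (wedge_range w m n))"
    using m by (simp add: wedge_range_Suc[of m n z] cinner_creation_op)
  also have "\<dots> = (\<Sum>b\<in>{m..<n}. (if b = m then 1 else -1) * cinner (z m) (w b) *
      cinner (wedge_range z (Suc m) n) (wedge_range (w \<circ> Transposition.transpose m b) (Suc m) n))"
    using m by (auto simp: annihilation_wedge_range right right_sum cinner_commute[of "z m"]
        intro!: sum.cong)
  also have "\<dots> = (\<Sum>b\<in>{m..<n}. \<Sum>q | q permutes {Suc m..<n}.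
      of_int (sign (Transposition.transpose m b \<circ> q)) *
      (\<Prod>i\<in>{m..<n}. cinner (z i) (w ((Transposition.transpose m b \<circ> q) i))))"
  proof (intro sum.cong refl)
    fix b assume b: "b \<in> {m..<n}"
    have IH: "cinner (wedge_range z (Suc m) n) (wedge_range (w \<circ> Transposition.transpose m b) (Suc m) n) =
      (\<Sum>q | q permutes {Suc m..<n}. of_int (sign q) *
        (\<Prod>i\<in>{Suc m..<n}. cinner (z i) ((w \<circ> Transposition.transpose m b) (q i))))"
      using Suc.hyps m by (intro Suc.hyps(1)) auto
    show "(if b = m then 1 else -1) * cinner (z m) (w b) *
      cinner (wedge_range z (Suc m) n) (wedge_range (w \<circ> Transposition.transpose m b) (Suc m) n) =
      (\<Sum>q | q permutes {Suc m..<n}. of_int (sign (Transposition.transpose m b \<circ> q)) *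
        (\<Prod>i\<in>{m..<n}. cinner (z i) (w ((Transposition.transpose m b \<circ> q) i))))"
      unfolding IH sum_distrib_left
    proof (intro sum.cong refl)
      fix q assume "q \<in> {q. q permutes {Suc m..<n}}"
      then have q: "q permutes {Suc m..<n}" by simp
      have qm: "q m = m" using q by (simp add: permutes_not_in)
      have "permutation q" using q by (auto simp: permutation_permutes)
      then have "sign (Transposition.transpose m b \<circ> q) = (if b = m then 1 else -1) * sign q"
        by (simp add: sign_compose permutation_swap_id sign_swap_id)
      then show "(if b = m then 1 else -1) * cinner (z m) (w b) * (of_int (sign q) *
          (\<Prod>i\<in>{Suc m..<n}. cinner (z i) ((w \<circ> Transposition.transpose m b) (q i)))) =
        of_int (sign (Transposition.transpose m b \<circ> q)) *
          (\<Prod>i\<in>{m..<n}. cinner (z i) (w ((Transposition.transpose m b \<circ> q) i)))"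
        by (simp add: I qm)
    qed
  qed
  also have "\<dots> = (\<Sum>p | p permutes {m..<n}. of_int (sign p) *
      (\<Prod>i\<in>{m..<n}. cinner (z i) (w (p i))))"
    unfolding I by (rule sum_over_permutations_insert[symmetric]) auto
  finally show ?case .
qed

lemma wedge_list_nth_eq_0: "card S \<noteq> length zs \<Longrightarrow> wedge_list zs $ S = 0"
proof (induction zs arbitrary: S)
  case Nil
  then show ?case by (auto simp: wedge_list_def axis_def)
next
  case (Cons z zs)
  have "wedge_list (z # zs) = creation_op z (wedge_list zs)"
    by (simp add: wedge_list_def)
  moreover have "wedge_list zs $ (S - {k}) = 0" if "k \<in> S" for k
    using that Cons.prems card_Suc_Diff1[of S k] by (intro Cons.IH) auto
  ultimately show ?case
    by (auto simp: creation_op_nth intro!: sum.neutral)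
qed

lemma cinner_wedge_list_degree:
  assumes "length zs \<noteq> length ws"
  shows "cinner (wedge_list zs) (wedge_list ws) = 0"
proof -
  have "wedge_list zs $ S = 0 \<or> wedge_list ws $ S = 0" for S
    using assms wedge_list_nth_eq_0 by metis
  then show ?thesis
    unfolding cinner_vec_def cinner_complex_def by (intro sum.neutral) auto
qed

text \<open>
  The inner product of \<^typ>\<open>complex^('d set)\<close> is the natural one of the exterior algebra: different
  degrees are orthogonal, and within a degree it is given by the determinant of the inner products
  (here in the form of the Leibniz formula).
\<close>

lemma cinner_wedge_list:
  assumes "length zs = length ws"
  shows "cinner (wedge_list zs) (wedge_list ws) =
    (\<Sum>p | p permutes {..<length ws}.
      of_int (sign p) * (\<Prod>i<length ws. cinner (zs ! i) (ws ! p i)))"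
  using cinner_wedge_range[of 0 "length ws" "\<lambda>i. zs ! i" "\<lambda>i. ws ! i"] assms
  by (simp add: wedge_range_def map_nth atLeast0LessThan) (metis map_nth)


section \<open>The Dirac operator of a commuting tuple\<close>

text \<open>
  Since the exterior algebra is finite-dimensional with the orthonormal basis \<^term>\<open>axis S 1\<close>, its
  tensor product with \<open>H\<close> consists of the \<open>H\<close>-valued vectors indexed by the sets \<open>S\<close>. The
  elementary tensor of \<open>h\<close> and \<open>x\<close> is \<open>tensor_vec h x\<close>.
\<close>

definition tensor_space :: "'a::complex_inner set \<Rightarrow> ('a^'n::finite) set"
  where "tensor_space H = {f. \<forall>i. f $ i \<in> H}"

definition tensor_vec :: "'a::complex_inner \<Rightarrow> complex^'n::finite \<Rightarrow> 'a^'n"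
  where "tensor_vec h x = (\<chi> i. (x $ i) *\<^sub>C h)"

definition tensor_op ::
  "('a::complex_inner \<Rightarrow> 'a) \<Rightarrow> (complex^'n::finite \<Rightarrow> complex^'n) \<Rightarrow> 'a^'n \<Rightarrow> 'a^'n"
  where "tensor_op T M f = (\<chi> i. \<Sum>j\<in>UNIV. (matrix M $ i $ j) *\<^sub>C T (f $ j))"

lemma cinner_tensor_vec:
  "cinner (tensor_vec h x) (tensor_vec h' x') = cinner h h' * cinner x x'"
proof -
  have right: "cinner y (a *\<^sub>C z) = cnj a * cinner y z" for a and y z :: 'a
    by (metis cinner_commute cinner_scaleC_left complex_cnj_mult)
  show ?thesis
    by (simp add: cinner_vec_def tensor_vec_def cinner_complex_def cinner_scaleC_left right
        sum_distrib_left mult_ac)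
qed

lemma tensor_op_tensor_vec:
  assumes "clinear_on H T" "h \<in> H" "Vector_Spaces.linear (*s) (*s) M"
  shows "tensor_op T M (tensor_vec h x) = tensor_vec (T h) (M x)"
proof -
  have sum_left: "(\<Sum>j\<in>A. f j) *\<^sub>C v = (\<Sum>j\<in>A. f j *\<^sub>C v)" if "finite A" for A f and v :: 'a
    using that
  proof (induction A)
    case empty
    then show ?case using scaleR_scaleC[of 0 v] by simp
  qed (simp_all add: scaleC_add_left)
  have "M x = matrix M *v x"
    using assms(3) by (simp add: matrix_works)
  then show ?thesis
    using assms(1,2)
    by (simp add: tensor_op_def tensor_vec_def vec_eq_iff clinear_on_def scaleC_scaleC
        matrix_vector_mult_def sum_left)
qed

definition commuting_tuple :: "'a::complex_inner set \<Rightarrow> ('d \<Rightarrow> 'a \<Rightarrow> 'a) \<Rightarrow> bool"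
  where "commuting_tuple H T \<longleftrightarrow>
    (\<forall>k. T k \<in> bounded_ops H) \<and> (\<forall>j k. \<forall>x\<in>H. T j (T k x) = T k (T j x))"

definition boundary_op ::
  "('d::{finite,linorder} \<Rightarrow> 'a::complex_inner \<Rightarrow> 'a) \<Rightarrow> 'a^('d set) \<Rightarrow> 'a^('d set)"
  where "boundary_op T f = (\<Sum>k\<in>UNIV. tensor_op (T k) (creation_op (axis k 1)) f)"

definition dirac_of_tuple ::
  "'a::complex_inner set \<Rightarrow> ('d::{finite,linorder} \<Rightarrow> 'a \<Rightarrow> 'a) \<Rightarrow> ('a^('d set), 'd) dirac_pair"
  where "dirac_of_tuple H T =
    (\<lambda>f. boundary_op T f + adjoint_on (tensor_space H) (boundary_op T) f,
     \<lambda>z. tensor_op (\<lambda>h. h) (\<lambda>x. creation_op z x + adjoint_on UNIV (creation_op z) x))"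

end

theory Submission
  imports Defs
begin

text \<open>
  The operators \<open>c\<^sub>k = C(e\<^sub>k)\<close> and \<open>a\<^sub>k = C(e\<^sub>k)\<^sup>*\<close> of a Clifford structure satisfy the canonical
  anticommutation relations, so \<open>K\<close> is the tensor product of its vacuum
  \<open>H = {h. a\<^sub>k h = 0 for all k}\<close> and the exterior algebra. By (D3), \<open>A\<^sub>k = a\<^sub>k D + D a\<^sub>k\<close> commutes
  with the Clifford structure, so it is given by an operator \<open>T\<^sub>k\<close> on \<open>H\<close>. For \<open>h\<close> in the vacuum,
  \<open>D h - (\<Sum>k. c\<^sub>k A\<^sub>k h)\<close> is again in the vacuum and by (D1) it is odd, hence \<open>0\<close>; this determines \<open>D\<close>.
  By (D2) the component of degree 2 of \<open>D\<^sup>2 h\<close> vanishes, which says that the \<open>T\<^sub>k\<close> commute.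
  Conversely an isomorphism maps vacuum to vacuum, and \<open>T\<^sub>k\<close> is recovered from \<open>D\<close> there.
\<close>


section \<open>Complex inner products\<close>

text \<open>\<open>adjoint_on\<close> is a definite description and \<open>gauge_group\<close> an
  exponential series, so both have to be made computable. For adjoints of bounded operators this is
  the Riesz representation on a complete carrier. For the gauge group it is the fact that every
  vector of \<open>K\<close> is a finite sum of eigenvectors of the number operator with integer
  eigenvalues; its adjoint is evaluated only at vacuum vectors, which it fixes. The values of
  \<open>D\<close> on the vacuum determine \<open>D\<close> because the adjoint of
  \<open>A\<^sub>k\<close>, namely \<open>c\<^sub>k D + D c\<^sub>k\<close>, also commutes with the
  Clifford structure: it gives \<open>D c\<^sub>k = A\<^sub>k\<^sup>* - c\<^sub>k D\<close>, which
  carries the values of \<open>D\<close> along the creation operators. The outcome is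
  \<open>D = B + B\<^sup>*\<close> with \<open>B = \<Sum>k. c\<^sub>k A\<^sub>k\<close>, the shape
  of the Dirac operator of a tuple. The linear order on the index type fixes the order of the
  factors in a monomial and so makes its signs agree with \<open>ext_sign\<close>.\<close>

global_interpretation scaleC: vector_space scaleC
  by standard (simp_all add: scaleC_add_right scaleC_add_left scaleC_scaleC scaleC_one)

lemma cinner_add_right: "cinner x (y + z) = cinner x y + cinner x z"
  by (metis cinner_commute cinner_add_left complex_cnj_add)

lemma cinner_scaleC_right: "cinner x (a *\<^sub>C y) = cnj a * cinner x y"
  by (metis cinner_commute cinner_scaleC_left complex_cnj_mult)

lemma cinner_zero_left [simp]: "cinner 0 x = 0"
  using cinner_add_left[of 0 0 x] by simp

lemma cinner_zero_right [simp]: "cinner x 0 = 0"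
  using cinner_add_right[of x 0 0] by simp

lemma cinner_minus_left [simp]: "cinner (- x) y = - cinner x y"
  using cinner_add_left[of x "- x" y] by (simp add: eq_neg_iff_add_eq_0 add.commute)

lemma cinner_minus_right [simp]: "cinner x (- y) = - cinner x y"
  using cinner_add_right[of x y "- y"] by (simp add: eq_neg_iff_add_eq_0 add.commute)

lemma cinner_diff_left: "cinner (x - y) z = cinner x z - cinner y z"
  using cinner_add_left[of x "- y" z] by simp

lemma cinner_diff_right: "cinner x (y - z) = cinner x y - cinner x z"
  using cinner_add_right[of x y "- z"] by simp

lemma cinner_sum_left: "cinner (\<Sum>i\<in>A. f i) y = (\<Sum>i\<in>A. cinner (f i) y)"
  by (induction A rule: infinite_finite_induct) (simp_all add: cinner_add_left)

lemma cinner_sum_right: "cinner x (\<Sum>i\<in>A. f i) = (\<Sum>i\<in>A. cinner x (f i))"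
  by (induction A rule: infinite_finite_induct) (simp_all add: cinner_add_right)

lemma cinner_self: "cinner x x = of_real ((norm x)\<^sup>2)"
proof (rule complex_eqI)
  show "Re (cinner x x) = Re (of_real ((norm x)\<^sup>2))"
    by (simp flip: inner_eq_Re_cinner add: power2_norm_eq_inner)
  have "Im (cinner x x) = Im (cnj (cinner x x))"
    using cinner_commute by metis
  then show "Im (cinner x x) = Im (of_real ((norm x)\<^sup>2))"
    by simp
qed

lemma cinner_self_eq_0: "cinner x x = 0 \<longleftrightarrow> x = 0"
  by (simp add: cinner_self)

lemma norm_scaleC: "norm (a *\<^sub>C x) = cmod a * norm x"
proof -
  have "cinner (a *\<^sub>C x) (a *\<^sub>C x) = (a * cnj a) * cinner x x"
    by (simp add: cinner_scaleC_left cinner_scaleC_right mult_ac)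
  then have "of_real ((norm (a *\<^sub>C x))\<^sup>2) = (of_real ((cmod a * norm x)\<^sup>2) :: complex)"
    by (simp only: cinner_self complex_norm_square power_mult_distrib of_real_mult)
  then have "(norm (a *\<^sub>C x))\<^sup>2 = (cmod a * norm x)\<^sup>2"
    by (simp only: of_real_eq_iff)
  then show ?thesis
    by simp
qed

text \<open>Multiplying \<open>x\<close> by a suitable phase makes the inner product real and
  nonnegative, so that the real Cauchy-Schwarz inequality applies.\<close>

lemma cmod_cinner_le: "cmod (cinner x y) \<le> norm x * norm y"
proof (cases "cinner x y = 0")
  case False
  define u where "u = cnj (cinner x y) / of_real (cmod (cinner x y))"
  have u: "cmod u = 1" "u * cinner x y = of_real (cmod (cinner x y))"
    using False complex_norm_square[of "cinner x y"]
    by (auto simp: u_def norm_divide power2_eq_square field_simps)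
  have "cmod (cinner x y) = inner (u *\<^sub>C x) y"
    using u by (simp add: inner_eq_Re_cinner cinner_scaleC_left)
  also have "\<dots> \<le> norm (u *\<^sub>C x) * norm y"
    by (rule norm_cauchy_schwarz)
  finally show ?thesis
    using u by (simp add: norm_scaleC)
qed simp

text \<open>Lets the scalar exponential series act on a fixed vector term by term.\<close>

lemma bounded_linear_scaleC_left: "bounded_linear (\<lambda>a. a *\<^sub>C x)"
  by (rule bounded_linear_intro[of _ "norm x"])
    (simp_all add: scaleC_add_left scaleR_scaleC[of _ x] scaleR_scaleC[of _ "_ *\<^sub>C x"]
      scaleC_scaleC norm_scaleC scaleR_conv_of_real)


section \<open>Hilbert spaces and adjoints\<close>

context
  fixes K :: "'a::complex_inner set"
  assumes K: "hilbert_space K"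
begin

lemma hilbert_space_zero: "0 \<in> K"
  and hilbert_space_add: "x \<in> K \<Longrightarrow> y \<in> K \<Longrightarrow> x + y \<in> K"
  and hilbert_space_scaleC: "x \<in> K \<Longrightarrow> a *\<^sub>C x \<in> K"
  and hilbert_space_complete: "complete K"
  using K by (auto simp: hilbert_space_def)

lemma hilbert_space_minus: "x \<in> K \<Longrightarrow> - x \<in> K"
  using hilbert_space_scaleC[of x "-1"] by simp

lemma hilbert_space_scaleR: "x \<in> K \<Longrightarrow> r *\<^sub>R x \<in> K"
  by (simp add: scaleR_scaleC hilbert_space_scaleC)

lemma hilbert_space_diff: "x \<in> K \<Longrightarrow> y \<in> K \<Longrightarrow> x - y \<in> K"
  using hilbert_space_add[of x "- y"] hilbert_space_minus[of y] by simp

lemma hilbert_space_sum: "(\<And>i. i \<in> A \<Longrightarrow> f i \<in> K) \<Longrightarrow> (\<Sum>i\<in>A. f i) \<in> K"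
  by (induction A rule: infinite_finite_induct)
    (simp_all add: hilbert_space_zero hilbert_space_add)

lemmas hilbert_space_mem = hilbert_space_zero hilbert_space_add hilbert_space_scaleC
  hilbert_space_minus hilbert_space_scaleR hilbert_space_diff hilbert_space_sum

lemma cinner_cancel_left:
  assumes "v \<in> K" "w \<in> K" "\<And>x. x \<in> K \<Longrightarrow> cinner x v = cinner x w"
  shows "v = w"
proof -
  have "cinner (v - w) (v - w) = 0"
    using assms hilbert_space_diff[of v w] by (simp add: cinner_diff_right)
  then show ?thesis
    by (simp add: cinner_self_eq_0)
qed

lemma clinear_on_zero: "clinear_on K X \<Longrightarrow> X 0 = 0"
  using hilbert_space_zero unfolding clinear_on_def by (metis add_cancel_left_left)

lemma clinear_on_minus: "clinear_on K X \<Longrightarrow> x \<in> K \<Longrightarrow> X (- x) = - X x"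
  unfolding clinear_on_def by (metis scaleC.scale_minus_left scaleC.scale_one)

lemma clinear_on_diff:
  "clinear_on K X \<Longrightarrow> x \<in> K \<Longrightarrow> y \<in> K \<Longrightarrow> X (x - y) = X x - X y"
  using clinear_on_minus[of X y] hilbert_space_minus[of y]
  unfolding clinear_on_def by (metis diff_conv_add_uminus)

lemma clinear_on_sum:
  assumes "clinear_on K X" "\<And>i. i \<in> A \<Longrightarrow> f i \<in> K"
  shows "X (\<Sum>i\<in>A. f i) = (\<Sum>i\<in>A. X (f i))"
  using assms(2)
proof (induction A rule: infinite_finite_induct)
  case (insert i A)
  then show ?case
    using assms(1) hilbert_space_sum[of A f] by (simp add: clinear_on_def)
qed (simp_all add: clinear_on_zero[OF assms(1)])

text \<open>The representing vector minimises \<open>x \<mapsto> \<parallel>x\<parallel>\<^sup>2 - 2 Re (f x)\<close>; the parallelogram law makes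
  every minimising sequence Cauchy.\<close>

lemma riesz_representation:
  assumes lin: "clinear_on K f" and bnd: "\<And>x. x \<in> K \<Longrightarrow> cmod (f x) \<le> M * norm x"
  obtains v where "v \<in> K" "\<And>x. x \<in> K \<Longrightarrow> f x = cinner x v"
proof -
  define \<phi> where "\<phi> x = (norm x)\<^sup>2 - 2 * Re (f x)" for x
  have f_add: "f (x + y) = f x + f y" if "x \<in> K" "y \<in> K" for x y
    using lin that by (simp add: clinear_on_def)
  have f_scaleR: "f (r *\<^sub>R x) = r *\<^sub>R f x" if "x \<in> K" for r x
    using lin that by (simp add: clinear_on_def scaleR_scaleC)
  have f_le: "Re (f x) \<le> M * norm x" if "x \<in> K" for x
    using bnd[OF that] complex_Re_le_cmod[of "f x"] by linarith
  have "- M\<^sup>2 \<le> \<phi> x" if "x \<in> K" for x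
  proof -
    have "0 \<le> (norm x - M)\<^sup>2" by simp
    then show ?thesis
      using f_le[OF that] unfolding \<phi>_def power2_diff by (simp add: mult.commute)
  qed
  then have bdd: "bdd_below (\<phi> ` K)"
    by (meson bdd_belowI2)
  define m where "m = Inf (\<phi> ` K)"
  have m_le: "m \<le> \<phi> x" if "x \<in> K" for x
    unfolding m_def using bdd that by (intro cInf_lower) auto
  have "\<exists>x\<in>K. \<phi> x < m + 1 / real (Suc n)" for n
  proof (rule ccontr)
    assume "\<not> ?thesis"
    then have "m + 1 / real (Suc n) \<le> m"
      using hilbert_space_zero unfolding m_def by (intro cInf_greatest) (auto simp: not_less)
    then show False by simp
  qed
  then obtain s where s: "\<And>n. s n \<in> K" "\<And>n. \<phi> (s n) < m + 1 / real (Suc n)"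
    by metis
  have par: "(norm (x - y))\<^sup>2 \<le> 2 * (\<phi> x - m) + 2 * (\<phi> y - m)" if "x \<in> K" "y \<in> K" for x y
  proof -
    have "m \<le> \<phi> ((1/2) *\<^sub>R (x + y))"
      using that by (intro m_le hilbert_space_mem)
    also have "\<phi> ((1/2) *\<^sub>R (x + y)) = (norm (x + y))\<^sup>2 / 4 - Re (f x) - Re (f y)"
      using that by (simp add: \<phi>_def f_scaleR hilbert_space_add f_add power_divide
          add_divide_distrib del: scaleR_add_right)
    finally show ?thesis
      by (simp add: \<phi>_def power2_norm_eq_inner inner_add_left inner_add_right inner_diff_left
          inner_diff_right inner_commute field_simps)
  qed
  have "Cauchy s"
  proof (rule metric_CauchyI)
    fix e :: real assume "0 < e"
    then obtain n where n: "inverse (real (Suc n)) < e\<^sup>2 / 4"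
      using reals_Archimedean[of "e\<^sup>2 / 4"] by auto
    have "dist (s i) (s j) < e" if "n \<le> i" "n \<le> j" for i j
    proof -
      have "\<phi> (s k) < m + e\<^sup>2 / 4" if "n \<le> k" for k
      proof -
        have "1 / real (Suc k) < e\<^sup>2 / 4"
          using n that frac_le[of 1 1 "real (Suc n)" "real (Suc k)"]
          by (auto simp: inverse_eq_divide)
        then show ?thesis
          using s(2)[of k] by (meson add_strict_left_mono less_trans)
      qed
      from this[OF that(1)] this[OF that(2)] have "(norm (s i - s j))\<^sup>2 < e\<^sup>2"
        using par[OF s(1) s(1), of i j] by argo
      then show ?thesis
        using \<open>0 < e\<close> by (simp add: dist_norm power_less_imp_less_base)
    qed
    then show "\<exists>N. \<forall>i\<ge>N. \<forall>j\<ge>N. dist (s i) (s j) < e" by blast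
  qed
  then obtain v where v: "v \<in> K" "s \<longlonglongrightarrow> v"
    using s(1) hilbert_space_complete unfolding complete_def by blast
  have f_lim: "(\<lambda>n. f (s n)) \<longlonglongrightarrow> f v"
  proof (rule LIM_zero_cancel, rule Lim_null_comparison)
    show "\<forall>\<^sub>F n in sequentially. norm (f (s n) - f v) \<le> M * norm (s n - v)"
      using bnd hilbert_space_diff[OF s(1) v(1)] clinear_on_diff[OF lin s(1) v(1)]
      by (intro always_eventually) metis
    show "(\<lambda>n. M * norm (s n - v)) \<longlonglongrightarrow> 0"
      using v(2) by (intro tendsto_mult_right_zero tendsto_norm_zero LIM_zero)
  qed
  have "(\<lambda>n. \<phi> (s n)) \<longlonglongrightarrow> \<phi> v"
    unfolding \<phi>_def using v f_lim by (intro tendsto_intros)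
  moreover have "(\<lambda>n. m + 1 / real (Suc n)) \<longlonglongrightarrow> m"
    using tendsto_add[OF tendsto_const LIMSEQ_inverse_real_of_nat, of m]
    by (simp add: inverse_eq_divide)
  ultimately have phi_v: "\<phi> v \<le> m"
    by (rule LIMSEQ_le) (use s(2) less_imp_le in blast)
  have re: "Re (f x) = inner x v" if "x \<in> K" for x
  proof (rule ccontr)
    assume neq: "Re (f x) \<noteq> inner x v"
    define b where "b = Re (f x) - inner x v"
    have q: "0 \<le> t\<^sup>2 * (norm x)\<^sup>2 - 2 * t * b" for t
    proof -
      have "\<phi> v \<le> \<phi> (v + t *\<^sub>R x)"
        using phi_v m_le[of "v + t *\<^sub>R x"] that v(1) hilbert_space_mem by fastforce
      also have "\<dots> = \<phi> v + t\<^sup>2 * (norm x)\<^sup>2 - 2 * t * b"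
        using that v(1) unfolding \<phi>_def power2_norm_eq_inner
        by (simp add: f_add f_scaleR hilbert_space_scaleR inner_add_left inner_add_right
            inner_commute b_def power2_eq_square algebra_simps)
      finally show ?thesis by simp
    qed
    show False
    proof (cases "x = 0")
      case True
      then show ?thesis using neq clinear_on_zero[OF lin] by simp
    next
      case False
      then have "0 < (norm x)\<^sup>2" by simp
      \<comment> \<open>\<open>b / (norm x)\<^sup>2\<close> minimises the quadratic in
        \<open>t\<close>, whose value there is negative because \<open>b\<close> is nonzero.\<close>
      then have "(b / (norm x)\<^sup>2)\<^sup>2 * (norm x)\<^sup>2 - 2 * (b / (norm x)\<^sup>2) * b = - (b\<^sup>2 / (norm x)\<^sup>2)"
        by (simp add: field_simps power2_eq_square)
      moreover have "0 < b\<^sup>2 / (norm x)\<^sup>2"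
        using neq \<open>0 < (norm x)\<^sup>2\<close> by (simp add: b_def)
      ultimately show ?thesis
        using q[of "b / (norm x)\<^sup>2"] by linarith
    qed
  qed
  have "f x = cinner x v" if "x \<in> K" for x
  proof (rule complex_eqI)
    show "Re (f x) = Re (cinner x v)"
      using re[OF that] by (simp add: inner_eq_Re_cinner)
    \<comment> \<open>Complex linearity recovers the imaginary part at \<open>x\<close> from the
      real part at \<open>\<i> *\<^sub>C x\<close>.\<close>
    have "f (\<i> *\<^sub>C x) = \<i> * f x"
      using lin that by (simp add: clinear_on_def scaleC_complex_def)
    then show "Im (f x) = Im (cinner x v)"
      using re[of "\<i> *\<^sub>C x"] that
      by (simp add: inner_eq_Re_cinner hilbert_space_scaleC cinner_scaleC_left)
  qed
  with v(1) show thesis by (rule that)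
qed

text \<open>Adjoints are computed one vector at a time by exhibiting a candidate; uniqueness is the
  nondegeneracy of the inner product. In this pointwise form it also serves for the gauge group at a
  vacuum vector.\<close>

lemma adjoint_on_eqI:
  assumes "v \<in> K" "\<And>x. x \<in> K \<Longrightarrow> cinner (X x) y = cinner x v"
  shows "adjoint_on K X y = v"
  unfolding adjoint_on_def using assms by (intro the_equality) (auto intro!: cinner_cancel_left)

text \<open>By Cauchy-Schwarz the functional \<open>\<lambda>x. cinner (X x) y\<close> is bounded,
  and its Riesz vector is the value of the adjoint.\<close>

lemma adjoint_on_bounded_op:
  assumes "X \<in> bounded_ops K" "y \<in> K"
  shows "adjoint_on K X y \<in> K" "x \<in> K \<Longrightarrow> cinner (X x) y = cinner x (adjoint_on K X y)"
proof -
  obtain M where M: "\<And>x. x \<in> K \<Longrightarrow> norm (X x) \<le> M * norm x"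
    using assms by (auto simp: bounded_ops_def)
  have "clinear_on K (\<lambda>x. cinner (X x) y)"
    using assms by (auto simp: bounded_ops_def clinear_on_def cinner_add_left cinner_scaleC_left
        scaleC_complex_def)
  moreover have "cmod (cinner (X x) y) \<le> M * norm y * norm x" if "x \<in> K" for x
    using cmod_cinner_le[of "X x" y] mult_right_mono[OF M[OF that] norm_ge_zero[of y]]
    by (simp add: mult_ac)
  ultimately obtain v where v: "v \<in> K" "\<And>x. x \<in> K \<Longrightarrow> cinner (X x) y = cinner x v"
    using riesz_representation by blast
  with adjoint_on_eqI[OF v] show "adjoint_on K X y \<in> K"
    "x \<in> K \<Longrightarrow> cinner (X x) y = cinner x (adjoint_on K X y)" by auto
qed

lemma self_adjoint_on_cinner:
  assumes "self_adjoint_on K X" "x \<in> K" "y \<in> K"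
  shows "cinner (X x) y = cinner x (X y)"
  using assms adjoint_on_bounded_op(2)[of X y x] by (simp add: self_adjoint_on_def)

end


section \<open>Creation and annihilation on tensor products\<close>

text \<open>This is \<open>1 \<otimes> C\<^sub>0(e\<^sub>k)\<close> in coordinates. The sign counts
  the elements of \<open>U\<close> below \<open>k\<close>, past which the new factor has to be
  moved.\<close>

definition tensor_create :: "'d::{finite,linorder} \<Rightarrow> 'a::complex_inner^('d set) \<Rightarrow> 'a^('d set)"
  where "tensor_create k f = (\<chi> U. if k \<in> U then ext_sign U k *\<^sub>C f $ (U - {k}) else 0)"

definition tensor_annihilate :: "'d::{finite,linorder} \<Rightarrow> 'a::complex_inner^('d set) \<Rightarrow> 'a^('d set)"
  where "tensor_annihilate k f = (\<chi> U. if k \<in> U then 0 else ext_sign U k *\<^sub>C f $ (insert k U))"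

lemma cnj_ext_sign [simp]: "cnj (ext_sign S k) = ext_sign S k"
  by (simp add: ext_sign_def)

text \<open>Removing and inserting \<open>k\<close> are inverse bijections between the sets with and
  without \<open>k\<close>. This turns a sum over the targets of a creation into one over its
  sources.\<close>

lemma sum_insert_remove:
  fixes g :: "'d::finite set \<Rightarrow> 'b::comm_monoid_add"
  shows "(\<Sum>S\<in>UNIV. if k \<in> S then g S else 0) = (\<Sum>S\<in>UNIV. if k \<in> S then 0 else g (insert k S))"
proof -
  have "(\<Sum>S\<in>UNIV. if k \<in> S then g S else 0) = (\<Sum>S\<in>{S. k \<in> S}. g S)"
    by (simp add: sum.If_cases)
  also have "\<dots> = (\<Sum>S\<in>{S. k \<notin> S}. g (insert k S))"
    by (rule sum.reindex_bij_witness[of _ "insert k" "\<lambda>U. U - {k}"]) (auto simp: insert_absorb)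
  also have "\<dots> = (\<Sum>S\<in>UNIV. if k \<in> S then 0 else g (insert k S))"
    by (simp add: sum.If_cases Compl_eq)
  finally show ?thesis .
qed

lemma cinner_tensor_create: "cinner (tensor_create k f) g = cinner f (tensor_annihilate k g)"
proof -
  have "cinner (tensor_create k f) g =
      (\<Sum>U\<in>UNIV. if k \<in> U then ext_sign U k * cinner (f $ (U - {k})) (g $ U) else 0)"
    by (auto simp: cinner_vec_def tensor_create_def cinner_scaleC_left intro!: sum.cong)
  also have "\<dots> = cinner f (tensor_annihilate k g)"
    unfolding sum_insert_remove
    by (auto simp: cinner_vec_def tensor_annihilate_def cinner_scaleC_right ext_sign_insert
        insert_Diff_if intro!: sum.cong)
  finally show ?thesis .
qed

lemma hilbert_space_tensor_space:
  assumes H: "hilbert_space H"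
  shows "hilbert_space (tensor_space H :: ('a::complex_inner^'n::finite) set)"
proof -
  have "complete (tensor_space H :: ('a^'n) set)"
    unfolding complete_def
  proof (intro allI impI, elim conjE)
    fix s :: "nat \<Rightarrow> 'a^'n"
    assume s: "\<forall>n. s n \<in> tensor_space H" "Cauchy s"
    have "\<exists>l\<in>H. (\<lambda>n. s n $ i) \<longlonglongrightarrow> l" for i
    proof -
      have "Cauchy (\<lambda>n. s n $ i)"
        by (rule metric_CauchyI) (meson dist_vec_nth_le le_less_trans metric_CauchyD[OF s(2)])
      then show ?thesis
        using s(1) hilbert_space_complete[OF H] by (auto simp: complete_def tensor_space_def)
    qed
    then obtain l where l: "\<And>i. l i \<in> H" "\<And>i. (\<lambda>n. s n $ i) \<longlonglongrightarrow> l i" by metis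
    then have "s \<longlonglongrightarrow> (\<chi> i. l i)"
      by (intro vec_tendstoI) simp
    moreover have "(\<chi> i. l i) \<in> tensor_space H"
      using l(1) by (simp add: tensor_space_def)
    ultimately show "\<exists>l\<in>tensor_space H. s \<longlonglongrightarrow> l"
      by blast
  qed
  then show ?thesis
    using H by (auto simp: hilbert_space_def tensor_space_def scaleC_vec_def)
qed

lemma tensor_create_mem:
  "hilbert_space H \<Longrightarrow> f \<in> tensor_space H \<Longrightarrow> tensor_create k f \<in> tensor_space H"
  by (simp add: tensor_space_def tensor_create_def hilbert_space_mem)

lemma tensor_annihilate_mem:
  "hilbert_space H \<Longrightarrow> f \<in> tensor_space H \<Longrightarrow> tensor_annihilate k f \<in> tensor_space H"
  by (simp add: tensor_space_def tensor_annihilate_def hilbert_space_mem)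


text \<open>The form in which anticommutation at equal indices, and later the action of the gauge
  group, force a vector to vanish.\<close>

lemma real_vector_eq_minus_self: "x = - x \<longleftrightarrow> x = 0" for x :: "'a::real_vector"
proof
  assume "x = - x"
  then have "2 *\<^sub>R x = 0"
    by (metis add.right_inverse scaleR_2)
  then show "x = 0" by simp
qed simp


section \<open>Representations of the canonical anticommutation relations\<close>

text \<open>The adjoint relation is stated as an inner product identity, which keeps the definite
  description in \<open>adjoint_on\<close> out of the algebra. Boundedness is not assumed but
  follows from the relations, see \<open>norm_a_le\<close>.\<close>

locale car_representation =
  fixes K :: "'k::complex_inner set" and c a :: "'d::{finite,linorder} \<Rightarrow> 'k \<Rightarrow> 'k"
  assumes hilbert: "hilbert_space K"
    and c_mem [simp]: "x \<in> K \<Longrightarrow> c i x \<in> K"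
    and a_mem [simp]: "x \<in> K \<Longrightarrow> a i x \<in> K"
    and c_linear: "clinear_on K (c i)"
    and a_linear: "clinear_on K (a i)"
    and cinner_c: "x \<in> K \<Longrightarrow> y \<in> K \<Longrightarrow> cinner (c i x) y = cinner x (a i y)"
    and c_c: "x \<in> K \<Longrightarrow> c i (c j x) = - c j (c i x)"
    and a_a: "x \<in> K \<Longrightarrow> a i (a j x) = - a j (a i x)"
    and a_c: "x \<in> K \<Longrightarrow> a i (c j x) = (if i = j then x else 0) - c j (a i x)"
begin

lemmas K_mem [simp] = hilbert_space_mem[OF hilbert]

lemma c_simps [simp]:
  "c i 0 = 0"
  "x \<in> K \<Longrightarrow> c i (s *\<^sub>C x) = s *\<^sub>C c i x"
  "x \<in> K \<Longrightarrow> y \<in> K \<Longrightarrow> c i (x + y) = c i x + c i y"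
  "x \<in> K \<Longrightarrow> y \<in> K \<Longrightarrow> c i (x - y) = c i x - c i y"
  "x \<in> K \<Longrightarrow> c i (- x) = - c i x"
  using c_linear clinear_on_diff[OF hilbert c_linear] clinear_on_minus[OF hilbert c_linear]
    clinear_on_zero[OF hilbert c_linear]
  by (auto simp: clinear_on_def)

lemmas c_sum [simp] = clinear_on_sum[OF hilbert c_linear]

lemma a_simps [simp]:
  "a i 0 = 0"
  "x \<in> K \<Longrightarrow> a i (s *\<^sub>C x) = s *\<^sub>C a i x"
  "x \<in> K \<Longrightarrow> y \<in> K \<Longrightarrow> a i (x + y) = a i x + a i y"
  "x \<in> K \<Longrightarrow> y \<in> K \<Longrightarrow> a i (x - y) = a i x - a i y"
  "x \<in> K \<Longrightarrow> a i (- x) = - a i x"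
  using a_linear clinear_on_diff[OF hilbert a_linear] clinear_on_minus[OF hilbert a_linear]
    clinear_on_zero[OF hilbert a_linear]
  by (auto simp: clinear_on_def)

lemmas a_sum [simp] = clinear_on_sum[OF hilbert a_linear]

lemma cinner_a: "x \<in> K \<Longrightarrow> y \<in> K \<Longrightarrow> cinner (a i x) y = cinner x (c i y)"
  by (metis cinner_c cinner_commute)

lemma c_square: "x \<in> K \<Longrightarrow> c i (c i x) = 0"
  using c_c[of x i i] real_vector_eq_minus_self by metis

lemma a_square: "x \<in> K \<Longrightarrow> a i (a i x) = 0"
  using a_a[of x i i] real_vector_eq_minus_self by metis

text \<open>Pairing \<open>a i (c i x) + c i (a i x) = x\<close> with \<open>x\<close> splits the
  squared norm of \<open>x\<close> into those of \<open>a i x\<close> and \<open>c i x\<close>. The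
  bound makes the vacuum closed and, later, the tuple bounded.\<close>

lemma norm_a_le:
  assumes "x \<in> K"
  shows "norm (a i x) \<le> norm x"
proof -
  have "cinner (a i x) (a i x) + cinner (c i x) (c i x) = cinner x x"
    using assms by (simp add: cinner_a cinner_c a_c cinner_diff_right)
  then have "of_real ((norm (a i x))\<^sup>2 + (norm (c i x))\<^sup>2) = (of_real ((norm x)\<^sup>2) :: complex)"
    by (simp only: cinner_self of_real_add)
  then have "(norm (a i x))\<^sup>2 + (norm (c i x))\<^sup>2 = (norm x)\<^sup>2"
    by (simp only: of_real_eq_iff)
  then have "(norm (a i x))\<^sup>2 \<le> (norm x)\<^sup>2"
    by (metis le_add_same_cancel1 zero_le_power2)
  then show ?thesis
    by (rule power2_le_imp_le) simp
qed

section \<open>The vacuum, and how creation operators generate everything from it\<close>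

definition vacuum :: "'k set"
  where "vacuum = {h \<in> K. \<forall>k. a k h = 0}"

lemma vacuumI: "h \<in> K \<Longrightarrow> (\<And>k. a k h = 0) \<Longrightarrow> h \<in> vacuum"
  by (simp add: vacuum_def)

lemma vacuum_mem [simp]: "h \<in> vacuum \<Longrightarrow> h \<in> K"
  and a_vacuum [simp]: "h \<in> vacuum \<Longrightarrow> a k h = 0"
  by (auto simp: vacuum_def)

lemma hilbert_space_vacuum: "hilbert_space vacuum"
proof -
  have "complete vacuum"
    unfolding complete_def
  proof (intro allI impI, elim conjE)
    fix s :: "nat \<Rightarrow> 'k"
    assume s: "\<forall>n. s n \<in> vacuum" "Cauchy s"
    then obtain l where l: "l \<in> K" "s \<longlonglongrightarrow> l"
      using hilbert_space_complete[OF hilbert] unfolding complete_def by (meson vacuum_mem)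
    have "a k l = 0" for k
    proof -
      have "norm (a k l) \<le> norm (l - s n)" for n
      proof -
        have "a k (l - s n) = a k l"
          using l(1) s(1) by simp
        then show ?thesis
          using norm_a_le[of "l - s n" k] l(1) s(1) by simp
      qed
      moreover have "(\<lambda>n. norm (l - s n)) \<longlonglongrightarrow> 0"
        using tendsto_diff[OF tendsto_const l(2), of l] by (simp add: tendsto_norm_zero_iff)
      ultimately have "norm (a k l) \<le> 0"
        by (intro LIMSEQ_le_const) auto
      then show ?thesis by simp
    qed
    then have "l \<in> vacuum"
      using l(1) by (simp add: vacuumI)
    with l(2) show "\<exists>l\<in>vacuum. s \<longlonglongrightarrow> l"
      by blast
  qed
  then show ?thesis
    by (auto simp: hilbert_space_def intro!: vacuumI)
qed

text \<open>Every vector is a sum of \<open>a\<^sub>k (c\<^sub>k x)\<close> and \<open>c\<^sub>k (a\<^sub>k x)\<close>, and \<open>a\<^sub>k\<close> annihilates both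
  \<open>a\<^sub>k (c\<^sub>k x)\<close> and \<open>a\<^sub>k x\<close>; repeating this for every index ends in the vacuum.\<close>

lemma fock_induct [consumes 1, case_names vacuum creation add]:
  assumes x: "x \<in> K"
    and vac: "\<And>h. h \<in> vacuum \<Longrightarrow> P h"
    and cre: "\<And>k x. x \<in> K \<Longrightarrow> P x \<Longrightarrow> P (c k x)"
    and add: "\<And>x y. x \<in> K \<Longrightarrow> y \<in> K \<Longrightarrow> P x \<Longrightarrow> P y \<Longrightarrow> P (x + y)"
  shows "P x"
proof -
  \<comment> \<open>\<open>F\<close> contains the indices whose annihilation operators may still act
    nontrivially on \<open>x\<close>: an empty \<open>F\<close> means a vacuum vector,
    \<open>F = UNIV\<close> imposes no condition.\<close>
  have "\<And>x. x \<in> K \<Longrightarrow> (\<And>k. k \<notin> F \<Longrightarrow> a k x = 0) \<Longrightarrow> P x" if "finite F" for F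
    using that
  proof (induction F)
    case empty
    then show ?case by (auto intro!: vac vacuumI)
  next
    case (insert m F)
    have 1: "P (a m x)"
    proof (rule insert.IH)
      show "a k (a m x) = 0" if "k \<notin> F" for k
        using that insert.prems by (cases "k = m") (simp_all add: a_square a_a[of x k m])
    qed (use insert.prems in simp)
    have 2: "P (a m (c m x))"
    proof (rule insert.IH)
      show "a k (a m (c m x)) = 0" if "k \<notin> F" for k
      proof (cases "k = m")
        case False
        then have "a k (c m x) = 0"
          using that insert.prems by (simp add: a_c)
        then show ?thesis
          using insert.prems by (simp add: a_a[of _ k m])
      qed (use insert.prems in \<open>simp add: a_square\<close>)
    qed (use insert.prems in simp)
    have "x = a m (c m x) + c m (a m x)"
      using insert.prems by (simp add: a_c)
    then show ?case
      using add[OF _ _ 2 cre[OF _ 1, of m]] insert.prems by (metis a_mem c_mem)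
  qed
  from this[of UNIV] x show ?thesis by simp
qed

text \<open>The counterpart in \<open>K\<close> of \<open>h\<close> tensored with the basis vector
  \<open>axis S 1\<close>. The smallest index is the outermost factor, as in the exterior
  algebra.\<close>

definition monomial :: "'d set \<Rightarrow> 'k \<Rightarrow> 'k"
  where "monomial S h = foldr c (sorted_list_of_set S) h"

lemma foldr_c_mem [simp]: "h \<in> K \<Longrightarrow> foldr c xs h \<in> K"
  by (induction xs) simp_all

lemma monomial_mem [simp]: "h \<in> K \<Longrightarrow> monomial S h \<in> K"
  by (simp add: monomial_def)

lemma foldr_c_linear: "clinear_on K (foldr c xs)"
proof -
  have "foldr c xs (x + y) = foldr c xs x + foldr c xs y" if "x \<in> K" "y \<in> K" for x y
    using that by (induction xs) simp_all
  moreover have "foldr c xs (s *\<^sub>C x) = s *\<^sub>C foldr c xs x" if "x \<in> K" for s x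
    using that by (induction xs) simp_all
  ultimately show ?thesis by (simp add: clinear_on_def)
qed

lemma monomial_linear: "clinear_on K (monomial S)"
  using foldr_c_linear unfolding monomial_def .

text \<open>Moving \<open>c k\<close> to its sorted place passes one factor for each smaller entry,
  at the cost of a sign; meeting an equal factor gives zero.\<close>

lemma c_foldr:
  "h \<in> K \<Longrightarrow> sorted xs \<Longrightarrow> distinct xs \<Longrightarrow> c k (foldr c xs h) =
    (if k \<in> set xs then 0 else (-1) ^ length (filter (\<lambda>t. t < k) xs) *\<^sub>C foldr c (insort k xs) h)"
proof (induction xs)
  case (Cons x xs)
  consider "k = x" | "k < x" | "x < k" by fastforce
  then show ?case
  proof cases
    case 2
    then have "k \<notin> set (x # xs)" "filter (\<lambda>t. t < k) (x # xs) = []"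
      using Cons.prems by (auto simp: filter_empty_conv)
    then show ?thesis
      using less_imp_le[OF 2] by simp
  next
    case 3
    then have "c k (foldr c (x # xs) h) = - c x (c k (foldr c xs h))"
      using Cons.prems by (simp add: c_c[of _ k x])
    then show ?thesis
      using 3 Cons by (auto simp: not_le[symmetric])
  qed (use Cons.prems in \<open>simp add: c_square\<close>)
qed simp

text \<open>\<open>a k\<close> anticommutes with the factors of other indices. At the factor
  \<open>c k\<close> it cancels that factor, and the remaining term runs on to the vacuum, where it
  vanishes.\<close>

lemma a_foldr:
  "h \<in> vacuum \<Longrightarrow> sorted xs \<Longrightarrow> distinct xs \<Longrightarrow> a k (foldr c xs h) =
    (if k \<in> set xs then (-1) ^ length (filter (\<lambda>t. t < k) xs) *\<^sub>C foldr c (remove1 k xs) h else 0)"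
proof (induction xs)
  case (Cons x xs)
  show ?case
  proof (cases "k = x")
    case True
    then have "filter (\<lambda>t. t < k) (x # xs) = []"
      using Cons.prems by (auto simp: filter_empty_conv)
    then show ?thesis
      using True Cons by (simp add: a_c)
  next
    case False
    then show ?thesis
      using Cons by (auto simp: a_c)
  qed
qed simp

lemma length_filter_ext_sign:
  "(-1) ^ length (filter (\<lambda>t. t < k) (sorted_list_of_set S)) = ext_sign S k" for S :: "'d set"
  by (simp add: ext_sign_def distinct_length_filter Int_def conj_commute)

lemma c_monomial:
  "h \<in> K \<Longrightarrow> c k (monomial S h) = (if k \<in> S then 0 else ext_sign S k *\<^sub>C monomial (insert k S) h)"
  by (simp add: monomial_def c_foldr length_filter_ext_sign)

lemma a_monomial:
  "h \<in> vacuum \<Longrightarrow> a k (monomial S h) = (if k \<in> S then ext_sign S k *\<^sub>C monomial (S - {k}) h else 0)"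
  by (simp add: monomial_def a_foldr length_filter_ext_sign sorted_list_of_set.sorted_key_list_of_set_remove)

lemma cinner_monomial:
  assumes h: "h \<in> vacuum" and g: "g \<in> vacuum"
  shows "cinner (monomial S h) (monomial T g) = (if S = T then cinner h g else 0)"
proof -
  \<comment> \<open>Creations are peeled off the left and reappear on the right as annihilations,
    which shrinks \<open>T\<close>; hence \<open>T\<close> stays arbitrary in the induction.\<close>
  have "cinner (foldr c xs h) (monomial T g) = (if set xs = T then cinner h g else 0)"
    if "sorted xs" "distinct xs" for xs T
    using that
  proof (induction xs arbitrary: T)
    case Nil
    show ?case
    proof (cases "sorted_list_of_set T")
      case (Cons y ys)
      then have "monomial T g = c y (foldr c ys g)" "T \<noteq> {}"
        by (auto simp: monomial_def)
      moreover have "cinner h (c y (foldr c ys g)) = 0"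
        using h g by (simp flip: cinner_a)
      ultimately show ?thesis by auto
    qed (simp add: monomial_def)
  next
    case (Cons x xs)
    have "cinner (foldr c (x # xs) h) (monomial T g) = cinner (foldr c xs h) (a x (monomial T g))"
      using h g by (simp add: cinner_c)
    also have "\<dots> = (if x \<in> T \<and> set xs = T - {x} then ext_sign T x * cinner h g else 0)"
      using Cons g by (auto simp: a_monomial cinner_scaleC_right)
    also have "\<dots> = (if set (x # xs) = T then cinner h g else 0)"
    proof -
      have "x \<in> T \<and> set xs = T - {x} \<longleftrightarrow> set (x # xs) = T"
        using Cons.prems by auto
      \<comment> \<open>The head of a sorted list is the least element, so removing it costs no
        sign.\<close>
      moreover have "ext_sign (set (x # xs)) x = 1"
      proof -
        have "{t \<in> set (x # xs). t < x} = {}"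
          using Cons.prems by auto
        then show ?thesis
          unfolding ext_sign_def by (simp only: card.empty power_0)
      qed
      ultimately show ?thesis by (metis mult_1)
    qed
    finally show ?case .
  qed
  then show ?thesis
    by (simp add: monomial_def[of S])
qed

section \<open>The unitary from the tensor product of vacuum and exterior algebra onto
  \<open>K\<close>\<close>

definition fock_map :: "'k^('d set) \<Rightarrow> 'k"
  where "fock_map f = (\<Sum>S\<in>UNIV. monomial S (f $ S))"

lemma tensor_vacuum_mem [simp]: "f \<in> tensor_space vacuum \<Longrightarrow> f $ S \<in> vacuum"
  by (simp add: tensor_space_def)

lemma fock_map_mem: "f \<in> tensor_space vacuum \<Longrightarrow> fock_map f \<in> K"
  by (simp add: fock_map_def)

lemma fock_map_linear: "clinear_on (tensor_space vacuum) fock_map"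
  using monomial_linear
  by (simp add: clinear_on_def fock_map_def sum.distrib scaleC_vec_def scaleC.scale_sum_right)

lemma cinner_fock_map:
  assumes "f \<in> tensor_space vacuum" "g \<in> tensor_space vacuum"
  shows "cinner (fock_map f) (fock_map g) = cinner f g"
  using assms
  by (simp add: fock_map_def cinner_vec_def cinner_sum_left cinner_sum_right cinner_monomial)

lemma c_fock_map:
  assumes "f \<in> tensor_space vacuum"
  shows "c k (fock_map f) = fock_map (tensor_create k f)"
proof -
  have "fock_map (tensor_create k f) =
      (\<Sum>U\<in>UNIV. if k \<in> U then ext_sign U k *\<^sub>C monomial U (f $ (U - {k})) else 0)"
    using monomial_linear clinear_on_zero[OF hilbert monomial_linear] assms
    by (auto simp: fock_map_def tensor_create_def clinear_on_def intro!: sum.cong)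
  also have "\<dots> = (\<Sum>S\<in>UNIV. c k (monomial S (f $ S)))"
    unfolding sum_insert_remove using assms
    by (auto simp: c_monomial ext_sign_insert insert_Diff_if intro!: sum.cong)
  also have "\<dots> = c k (fock_map f)"
    using assms by (simp add: fock_map_def)
  finally show ?thesis by simp
qed

lemma a_fock_map:
  assumes "f \<in> tensor_space vacuum"
  shows "a k (fock_map f) = fock_map (tensor_annihilate k f)"
proof -
  have "a k (fock_map f) =
      (\<Sum>S\<in>UNIV. if k \<in> S then ext_sign S k *\<^sub>C monomial (S - {k}) (f $ S) else 0)"
    using assms by (auto simp: fock_map_def a_monomial intro!: sum.cong)
  also have "\<dots> = fock_map (tensor_annihilate k f)"
    unfolding sum_insert_remove
    using monomial_linear clinear_on_zero[OF hilbert monomial_linear] assms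
    by (auto simp: fock_map_def tensor_annihilate_def clinear_on_def ext_sign_insert insert_Diff_if
        intro!: sum.cong)
  finally show ?thesis .
qed

text \<open>The range contains the vacuum and is stable under creations and sums, so Fock induction
  shows that it is all of \<open>K\<close>.\<close>

lemma fock_map_surj:
  assumes "x \<in> K"
  obtains f where "f \<in> tensor_space vacuum" "x = fock_map f"
proof -
  have "\<exists>f\<in>tensor_space vacuum. x = fock_map f"
    using assms
  proof (induction rule: fock_induct)
    case (vacuum h)
    have "fock_map (\<chi> S. if S = {} then h else 0) = h"
      using clinear_on_zero[OF hilbert monomial_linear]
      by (simp add: fock_map_def monomial_def if_distrib[of "\<lambda>h. foldr c _ h"] cong: if_cong)
    moreover have "(\<chi> S. if S = {} then h else 0) \<in> tensor_space vacuum"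
      unfolding tensor_space_def using vacuum hilbert_space_zero[OF hilbert_space_vacuum] by simp
    ultimately show ?case by metis
  next
    case (creation k x)
    then show ?case
      by (metis c_fock_map tensor_create_mem hilbert_space_vacuum)
  next
    case (add x y)
    then show ?case
      using fock_map_linear hilbert_space_add[OF hilbert_space_tensor_space[OF hilbert_space_vacuum]]
      unfolding clinear_on_def by metis
  qed
  then show thesis using that by blast
qed

lemma unitary_fock_map: "unitary_on (tensor_space vacuum) K fock_map"
  unfolding unitary_on_def bij_betw_def
proof (intro conjI ballI)
  show "inj_on fock_map (tensor_space vacuum)"
  proof (rule inj_onI)
    fix f g
    assume f: "f \<in> tensor_space vacuum" and g: "g \<in> tensor_space vacuum"
      and eq: "fock_map f = fock_map g"
    show "f = g"
    proof (rule cinner_cancel_left[OF hilbert_space_tensor_space[OF hilbert_space_vacuum] f g])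
      fix e :: "'k^('d set)" assume "e \<in> tensor_space vacuum"
      then show "cinner e f = cinner e g"
        using eq f g by (metis cinner_fock_map)
    qed
  qed
  show "fock_map ` tensor_space vacuum = K"
    using fock_map_mem fock_map_surj by blast
qed (simp_all add: fock_map_linear cinner_fock_map)

end


section \<open>Clifford structures\<close>

text \<open>This is \<open>C(z)\<^sup>*\<close>: as the values of \<open>R\<close> are self-adjoint,
  passing to the adjoint of the creation part only flips the sign of the second term.\<close>

definition annihilation_part ::
  "(complex^'d::finite \<Rightarrow> 'a::complex_inner \<Rightarrow> 'a) \<Rightarrow> complex^'d \<Rightarrow> 'a \<Rightarrow> 'a"
  where "annihilation_part R z x = (1/2) *\<^sub>C (R z x + \<i> *\<^sub>C R (\<i> *s z) x)"

lemma imaginary_axis: "\<i> *s axis k 1 = (axis k \<i> :: complex^'d::finite)"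
  by (simp add: vec_eq_iff axis_def)

lemma scaleC_half_double: "(1/2) *\<^sub>C x + (1/2) *\<^sub>C x = x"
  by (simp flip: scaleC_add_left)

locale clifford_space =
  fixes K :: "'k::complex_inner set" and R :: "complex^'d::{finite,linorder} \<Rightarrow> 'k \<Rightarrow> 'k"
  assumes hilbert_K: "hilbert_space K" and clifford: "clifford_structure K R"
begin

lemma R_mem: "x \<in> K \<Longrightarrow> R z x \<in> K"
  and R_linear: "clinear_on K (R z)"
  and R_add: "x \<in> K \<Longrightarrow> R (z + w) x = R z x + R w x"
  and R_scaleR: "x \<in> K \<Longrightarrow> R (r *\<^sub>R z) x = r *\<^sub>R R z x"
  and R_square: "x \<in> K \<Longrightarrow> R z (R z x) = (norm z)\<^sup>2 *\<^sub>R x"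
  and R_self_adjoint: "self_adjoint_on K (R z)"
  using clifford by (auto simp: clifford_structure_def self_adjoint_on_def bounded_ops_def)

lemma R_simps:
  "x \<in> K \<Longrightarrow> R z (s *\<^sub>C x) = s *\<^sub>C R z x"
  "x \<in> K \<Longrightarrow> y \<in> K \<Longrightarrow> R z (x + y) = R z x + R z y"
  "x \<in> K \<Longrightarrow> y \<in> K \<Longrightarrow> R z (x - y) = R z x - R z y"
  using R_linear clinear_on_diff[OF hilbert_K R_linear] by (auto simp: clinear_on_def)

lemma R_sum: "x \<in> K \<Longrightarrow> R (\<Sum>i\<in>A. f i) x = (\<Sum>i\<in>A. R (f i) x)"
proof (induction A rule: infinite_finite_induct)
  case empty
  then show ?case using R_scaleR[of x 0 0] by simp
next
  case (infinite A)
  then show ?case using R_scaleR[of x 0 0] by simp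
qed (simp add: R_add)

text \<open>Polarisation of \<open>R_square\<close>. Here \<open>inner\<close> is the real inner
  product, for which \<open>axis k 1\<close> and \<open>axis k \<i>\<close> are orthogonal.\<close>

lemma R_anticommute:
  assumes "x \<in> K"
  shows "R z (R w x) = (2 * of_real (inner z w)) *\<^sub>C x - R w (R z x)"
proof -
  have "R (z + w) (R (z + w) x) = R z (R z x) + R w (R w x) + (R z (R w x) + R w (R z x))"
    using assms by (simp add: R_add R_simps R_mem hilbert_space_mem[OF hilbert_K])
  then have "R z (R w x) + R w (R z x) = ((norm (z + w))\<^sup>2 - (norm z)\<^sup>2 - (norm w)\<^sup>2) *\<^sub>R x"
    using assms by (simp add: R_square algebra_simps)
  also have "(norm (z + w))\<^sup>2 - (norm z)\<^sup>2 - (norm w)\<^sup>2 = 2 * inner z w"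
    by (simp add: power2_norm_eq_inner inner_add_left inner_add_right inner_commute)
  finally show ?thesis
    by (simp add: scaleR_scaleC eq_diff_eq)
qed

text \<open>The operators \<open>R (axis k 1)\<close> and \<open>R (axis k \<i>)\<close> anticommute
  pairwise and have square one; the relations follow by expanding products of their complex
  combinations.\<close>

sublocale car_representation K
  "\<lambda>k. creation_part R (axis k 1)" "\<lambda>k. annihilation_part R (axis k 1)"
proof
  note simps = creation_part_def annihilation_part_def imaginary_axis
  note K = R_mem hilbert_space_mem[OF hilbert_K]
  note distrib = scaleC.scale_right_distrib scaleC.scale_right_diff_distrib
  have orth: "R (axis i \<i>) (R (axis j 1) x) = - R (axis j 1) (R (axis i \<i>) x)"
    if "x \<in> K" for i j x
    using R_anticommute[OF that, of "axis i \<i>" "axis j 1"] by (simp add: inner_axis_axis)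
  have unit: "R (axis i s) (R (axis j s) x) = (if i = j then 2 else 0) *\<^sub>C x
      - R (axis j s) (R (axis i s) x)" if "x \<in> K" "cmod s = 1" for i j x s
    using R_anticommute[OF that(1), of "axis i s" "axis j s"] that(2)
    by (simp add: inner_axis_axis dot_square_norm)
  fix i j x y
  assume x: "x \<in> K"
  show "creation_part R (axis i 1) x \<in> K" "annihilation_part R (axis i 1) x \<in> K"
    using x by (simp_all add: simps K)
  show "creation_part R (axis i 1) (creation_part R (axis j 1) x) =
      - creation_part R (axis j 1) (creation_part R (axis i 1) x)"
    using x by (simp add: simps K R_simps orth unit[of _ 1 i j] unit[of _ \<i> i j] distrib)
  show "annihilation_part R (axis i 1) (annihilation_part R (axis j 1) x) =
      - annihilation_part R (axis j 1) (annihilation_part R (axis i 1) x)"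
    using x by (simp add: simps K R_simps orth unit[of _ 1 i j] unit[of _ \<i> i j] distrib)
  show "annihilation_part R (axis i 1) (creation_part R (axis j 1) x) =
      (if i = j then x else 0) - creation_part R (axis j 1) (annihilation_part R (axis i 1) x)"
    using x by (simp add: simps K R_simps orth unit[of _ 1 i j] unit[of _ \<i> i j] distrib
        scaleC_half_double)
  assume y: "y \<in> K"
  show "cinner (creation_part R (axis i 1) x) y = cinner x (annihilation_part R (axis i 1) y)"
    using x y by (simp add: simps cinner_scaleC_left cinner_scaleC_right cinner_add_right
        cinner_diff_left self_adjoint_on_cinner[OF hilbert_K R_self_adjoint] algebra_simps)
next
  fix i
  show "clinear_on K (creation_part R (axis i 1))" "clinear_on K (annihilation_part R (axis i 1))"
    by (simp_all add: clinear_on_def creation_part_def annihilation_part_def R_simps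
        algebra_simps)
qed (rule hilbert_K)

abbreviation c :: "'d \<Rightarrow> 'k \<Rightarrow> 'k" where "c k \<equiv> creation_part R (axis k 1)"
abbreviation a :: "'d \<Rightarrow> 'k \<Rightarrow> 'k" where "a k \<equiv> annihilation_part R (axis k 1)"

text \<open>\<open>R\<close> is only real-linear, so each coordinate is split into real and
  imaginary part and regrouped by itself and its conjugate. The result has the shape of
  \<open>dirac_of_tuple_clifford\<close>.\<close>

lemma R_expand:
  assumes "x \<in> K"
  shows "R z x = (\<Sum>k\<in>UNIV. z $ k *\<^sub>C c k x + cnj (z $ k) *\<^sub>C a k x)"
proof -
  have "R (axis k w) x = w *\<^sub>C c k x + cnj w *\<^sub>C a k x" for k w
  proof -
    have "axis k w = Re w *\<^sub>R axis k 1 + Im w *\<^sub>R axis k \<i>"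
      by (auto simp: vec_eq_iff axis_def complex_eq_iff)
    then have "R (axis k w) x = of_real (Re w) *\<^sub>C R (axis k 1) x + of_real (Im w) *\<^sub>C R (axis k \<i>) x"
      using assms by  (simp add: R_add R_scaleR scaleR_scaleC[where 'a = 'k])
    also have "\<dots> = ((w + cnj w) / 2) *\<^sub>C R (axis k 1) x
        + (cnj w * \<i> / 2 - w * \<i> / 2) *\<^sub>C R (axis k \<i>) x"
      by (intro arg_cong2[where f = "(+)"] arg_cong2[where f = scaleC] refl)
        (simp_all add: complex_eq_iff)
    also have "\<dots> = w *\<^sub>C c k x + cnj w *\<^sub>C a k x"
      by (simp add: creation_part_def annihilation_part_def imaginary_axis scaleC_scaleC
          scaleC.scale_right_distrib scaleC.scale_right_diff_distrib scaleC.scale_left_distrib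
          scaleC.scale_left_diff_distrib add_divide_distrib)
    finally show ?thesis .
  qed
  moreover have "z = (\<Sum>k\<in>UNIV. axis k (z $ k))"
    by (simp add: vec_eq_iff axis_def)
  ultimately show ?thesis
    using R_sum[OF assms, of "\<lambda>k. axis k (z $ k)" UNIV] by simp
qed


subsection \<open>The gauge group\<close>

lemma number_op_eq:
  assumes "x \<in> K"
  shows "number_op K R x = (\<Sum>k\<in>UNIV. c k (a k x))"
proof -
  have "adjoint_on K (c k) x = a k x" for k
    using assms by (intro adjoint_on_eqI[OF hilbert]) (simp_all add: cinner_c)
  then show ?thesis
    by (simp add: number_op_def)
qed

lemma number_op_mem [simp]: "x \<in> K \<Longrightarrow> number_op K R x \<in> K"
  by (simp add: number_op_eq)

lemma number_op_vacuum: "h \<in> vacuum \<Longrightarrow> number_op K R h = 0"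
  by (simp add: number_op_eq)

lemma number_op_sum:
  "(\<And>i. i \<in> A \<Longrightarrow> f i \<in> K) \<Longrightarrow> number_op K R (\<Sum>i\<in>A. f i) = (\<Sum>i\<in>A. number_op K R (f i))"
  by (simp add: number_op_eq) (rule sum.swap)

lemma number_op_scaleC: "x \<in> K \<Longrightarrow> number_op K R (s *\<^sub>C x) = s *\<^sub>C number_op K R x"
  by (simp add: number_op_eq scaleC.scale_sum_right)

text \<open>The commutator of the number operator with \<open>c j\<close> is \<open>c j\<close>
  itself, so a creation raises the eigenvalue by one.\<close>

lemma number_op_creation:
  assumes "x \<in> K" "number_op K R x = of_nat n *\<^sub>C x"
  shows "number_op K R (c j x) = of_nat (Suc n) *\<^sub>C c j x"
proof -
  have "c k (a k (c j x)) = (if k = j then c j x else 0) + c j (c k (a k x))" for k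
    using assms(1) by (simp add: a_c c_c[of _ k j])
  then have "number_op K R (c j x) = c j x + c j (number_op K R x)"
    using assms(1) by (simp add: number_op_eq sum.distrib)
  then show ?thesis
    using assms by (simp add: scaleC_add_left)
qed

lemma number_op_monomial:
  assumes "h \<in> vacuum"
  shows "number_op K R (monomial S h) = of_nat (card S) *\<^sub>C monomial S h"
proof -
  have "number_op K R (foldr c xs h) = of_nat (length xs) *\<^sub>C foldr c xs h" for xs
    using assms by (induction xs) (simp_all add: number_op_vacuum number_op_creation del: of_nat_Suc)
  from this[of "sorted_list_of_set S"] show ?thesis
    by (simp add: monomial_def)
qed

text \<open>On a sum of eigenvectors all powers in the series are explicit, which leaves scalar
  exponentials. Integer eigenvalues turn these into powers of \<open>u\<close>, and the choice of
  the argument disappears.\<close>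

lemma gauge_group_sum:
  assumes y: "\<And>i. i \<in> A \<Longrightarrow> y i \<in> K"
    and eigen: "\<And>i. i \<in> A \<Longrightarrow> number_op K R (y i) = of_nat (n i) *\<^sub>C y i"
    and u: "cmod u = 1"
  shows "gauge_group K R u (\<Sum>i\<in>A. y i) = (\<Sum>i\<in>A. u ^ n i *\<^sub>C y i)"
proof -
  define X where "X x = (\<i> * complex_of_real (Arg u)) *\<^sub>C number_op K R x" for x
  define e where "e i = \<i> * complex_of_real (Arg u) * of_nat (n i)" for i
  have pow: "(X ^^ m) (\<Sum>i\<in>A. y i) = (\<Sum>i\<in>A. e i ^ m *\<^sub>C y i)" for m
  proof (induction m)
    case (Suc m)
    have "X (\<Sum>i\<in>A. e i ^ m *\<^sub>C y i) = (\<Sum>i\<in>A. e i ^ Suc m *\<^sub>C y i)"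
      using y eigen by (simp add: X_def number_op_sum number_op_scaleC scaleC.scale_sum_right
          e_def mult_ac)
    then show ?case using Suc by simp
  qed simp
  have "exp (\<i> * complex_of_real (Arg u)) = u"
    using u cis_Arg[of u] by (cases "u = 0") (auto simp: cis_conv_exp sgn_div_norm)
  then have exp_e: "exp (e i) = u ^ n i" for i
    using exp_of_nat_mult[of "n i" "\<i> * complex_of_real (Arg u)"] by (simp add: e_def mult.commute)
  have "(\<lambda>m. \<Sum>i\<in>A. (e i ^ m /\<^sub>R fact m) *\<^sub>C y i) sums (\<Sum>i\<in>A. exp (e i) *\<^sub>C y i)"
    by (intro sums_sum bounded_linear.sums[OF bounded_linear_scaleC_left] exp_converges)
  moreover have "(\<Sum>i\<in>A. (e i ^ m /\<^sub>R fact m) *\<^sub>C y i) = (1 / fact m) *\<^sub>R (X ^^ m) (\<Sum>i\<in>A. y i)" for m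
    unfolding pow by (simp add: scaleR_scaleC scaleC.scale_sum_right scaleC_scaleC
        scaleC_complex_def field_simps)
  ultimately have "exp_op X (\<Sum>i\<in>A. y i) = (\<Sum>i\<in>A. u ^ n i *\<^sub>C y i)"
    unfolding exp_op_def exp_e by (simp add: sums_iff)
  then show ?thesis
    by (simp add: gauge_group_def X_def[abs_def])
qed

lemma gauge_group_vacuum_add:
  assumes y: "y \<in> vacuum" and x: "x \<in> K" "number_op K R x = of_nat n *\<^sub>C x" and u: "cmod u = 1"
  shows "gauge_group K R u (y + x) = y + u ^ n *\<^sub>C x"
proof -
  \<comment> \<open>The two summands are indexed by \<open>bool\<close> to make them a family of
    eigenvectors, of degree \<open>0\<close> and \<open>n\<close>.\<close>
  define z where "z b = (if b then x else y)" for b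
  define m where "m b = (if b then n else 0)" for b
  have "gauge_group K R u (\<Sum>b\<in>UNIV. z b) = (\<Sum>b\<in>UNIV. u ^ m b *\<^sub>C z b)"
    using y x u by (intro gauge_group_sum) (auto simp: z_def m_def number_op_vacuum)
  then show ?thesis
    by (simp add: UNIV_bool z_def m_def)
qed

text \<open>The gauge group scales each monomial by a power of \<open>u\<close>, and
  \<open>h\<close>, the monomial of the empty set, is orthogonal to all others, where the power
  could differ from one. This removes the adjoints from (D1) and (D2) at vacuum vectors.\<close>

lemma adjoint_gauge_group_vacuum:
  assumes h: "h \<in> vacuum" and u: "cmod u = 1"
  shows "adjoint_on K (gauge_group K R u) h = h"
proof (rule adjoint_on_eqI[OF hilbert])
  fix x assume "x \<in> K"
  then obtain f where f: "f \<in> tensor_space vacuum" "x = (\<Sum>S\<in>UNIV. monomial S (f $ S))"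
    unfolding fock_map_def[symmetric] by (rule fock_map_surj)
  have mon: "monomial {} h = h"
    by (simp add: monomial_def)
  have "gauge_group K R u x = (\<Sum>S\<in>UNIV. u ^ card S *\<^sub>C monomial S (f $ S))"
    unfolding f(2) using f(1) u by (intro gauge_group_sum) (simp_all add: number_op_monomial)
  moreover have "cinner (u ^ card S *\<^sub>C monomial S (f $ S)) (monomial {} h) =
      cinner (monomial S (f $ S)) (monomial {} h)" for S
    using f(1) h by (simp add: cinner_scaleC_left cinner_monomial)
  ultimately show "cinner (gauge_group K R u x) h = cinner x h"
    unfolding f(2) by (simp add: cinner_sum_left mon)
qed (use h in simp)

end


section \<open>The Dirac operator of a tuple in coordinates\<close>

lemma sum_axis_scaleC: "(\<Sum>T\<in>UNIV. (s * axis T 1 $ U) *\<^sub>C f T) = s *\<^sub>C f U"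
proof -
  have "(s * axis T 1 $ U) *\<^sub>C f T = (if T = U then s *\<^sub>C f T else 0)" for T
    by (auto simp: axis_def)
  then show ?thesis by simp
qed

text \<open>Evaluating \<open>matrix\<close> at basis vectors collapses the sum over the columns,
  leaving the same coordinate formula with vectors in place of scalars.\<close>

lemma tensor_op_nth:
  assumes "\<And>x S. M x $ S = (\<Sum>k\<in>I. g S k * x $ (h S k))"
  shows "tensor_op T M f $ S = (\<Sum>k\<in>I. g S k *\<^sub>C T (f $ (h S k)))"
proof -
  have "tensor_op T M f $ S = (\<Sum>U\<in>UNIV. \<Sum>k\<in>I. (g S k * axis U 1 $ (h S k)) *\<^sub>C T (f $ U))"
    by (simp add: tensor_op_def matrix_def assms scaleC.scale_sum_left)
  also have "\<dots> = (\<Sum>k\<in>I. \<Sum>U\<in>UNIV. (g S k * axis U 1 $ (h S k)) *\<^sub>C T (f $ U))"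
    by (rule sum.swap)
  finally show ?thesis
    by (simp add: sum_axis_scaleC)
qed

lemma boundary_op_eq: "boundary_op T f = (\<Sum>k\<in>UNIV. tensor_create k (\<chi> S. T k (f $ S)))"
proof -
  have "tensor_op (T k) (creation_op (axis k 1)) f = tensor_create k (\<chi> S. T k (f $ S))" for k
  proof -
    \<comment> \<open>A sum over a singleton, to match the premise of \<open>tensor_op_nth\<close>;
      the case \<open>k \<notin> S\<close> is absorbed by the coefficient.\<close>
    have "creation_op (axis k 1) x $ S =
        (\<Sum>j\<in>{k}. (if j \<in> S then ext_sign S j else 0) * x $ (S - {j}))" for x S
    proof -
      have "creation_op (axis k 1) x $ S =
          (\<Sum>j\<in>UNIV. if j = k then (if j \<in> S then ext_sign S j else 0) * x $ (S - {j}) else 0)"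
        unfolding creation_op_nth by (rule sum.cong) (auto simp: axis_def)
      then show ?thesis by simp
    qed
    from tensor_op_nth[OF this, of "T k" f] show ?thesis
      by (simp add: vec_eq_iff tensor_create_def)
  qed
  then show ?thesis
    by (simp add: boundary_op_def)
qed

lemma dirac_of_tuple_clifford:
  "snd (dirac_of_tuple H T) z f =
    (\<Sum>k\<in>UNIV. z $ k *\<^sub>C tensor_create k f + cnj (z $ k) *\<^sub>C tensor_annihilate k f)"
proof -
  \<comment> \<open>For each \<open>k\<close> exactly one of the two operators contributes to the
    coordinate \<open>S\<close>, according to whether \<open>k \<in> S\<close>.\<close>
  have "creation_op z x $ S + annihilation_op z x $ S =
      (\<Sum>k\<in>UNIV. (ext_sign S k * (if k \<in> S then z $ k else cnj (z $ k))) *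
        x $ (if k \<in> S then S - {k} else insert k S))" for x S
    unfolding creation_op_nth annihilation_op_def vec_lambda_beta sum.distrib[symmetric]
    by (rule sum.cong) auto
  from tensor_op_nth[of "\<lambda>x. creation_op z x + annihilation_op z x", unfolded vector_add_component,
      OF this, of "\<lambda>h. h" f]
  show ?thesis
    by (auto simp: dirac_of_tuple_def adjoint_creation_op vec_eq_iff tensor_create_def
        tensor_annihilate_def scaleC_vec_def scaleC_scaleC mult.commute intro!: sum.cong)
qed

lemma fst_dirac_of_tuple:
  "fst (dirac_of_tuple H T) f = boundary_op T f + adjoint_on (tensor_space H) (boundary_op T) f"
  by (simp add: dirac_of_tuple_def)

lemma boundary_op_mem:
  assumes "hilbert_space H" "\<And>k x. x \<in> H \<Longrightarrow> T k x \<in> H" "f \<in> tensor_space H"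
  shows "boundary_op T f \<in> tensor_space H"
  unfolding boundary_op_eq using assms
  by (intro hilbert_space_sum[OF hilbert_space_tensor_space] tensor_create_mem)
    (auto simp: tensor_space_def)

section \<open>Inverses of unitaries and of isomorphisms\<close>

lemma unitary_on_inv_into:
  assumes K: "hilbert_space K" and V: "unitary_on K K' V"
  shows "unitary_on K' K (inv_into K V)"
proof -
  have inj: "inj_on V K" and onto: "V ` K = K'"
    using V by (auto simp: unitary_on_def bij_betw_def)
  have inv: "inv_into K V (V x) = x" if "x \<in> K" for x
    using inv_into_f_f[OF inj that] .
  have add: "V (x + y) = V x + V y" and scale: "V (s *\<^sub>C x) = s *\<^sub>C V x" if "x \<in> K" "y \<in> K" for x y s
    using V that by (auto simp: unitary_on_def clinear_on_def)
  have "clinear_on K' (inv_into K V)"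
    unfolding clinear_on_def onto[symmetric]
    by (auto simp: inv hilbert_space_mem[OF K] simp flip: add scale)
  moreover have "cinner (inv_into K V x) (inv_into K V y) = cinner x y" if "x \<in> K'" "y \<in> K'" for x y
    using V that unfolding unitary_on_def onto[symmetric] by (auto simp: inv)
  ultimately show ?thesis
    using V bij_betw_inv_into by (auto simp: unitary_on_def)
qed

text \<open>The Fock map runs from the tensor space to \<open>K\<close>, against the direction of
  the isomorphism wanted.\<close>

lemma dirac_isomorphic_sym:
  assumes K: "hilbert_space K" and iso: "dirac_isomorphic K (D, R) K' (D', R')"
    and mem: "\<And>x. x \<in> K \<Longrightarrow> D x \<in> K" "\<And>z x. x \<in> K \<Longrightarrow> R z x \<in> K"
  shows "dirac_isomorphic K' (D', R') K (D, R)"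
proof -
  obtain V where V: "unitary_on K K' V" "\<And>x. x \<in> K \<Longrightarrow> V (D x) = D' (V x)"
    "\<And>z x. x \<in> K \<Longrightarrow> V (R z x) = R' z (V x)"
    using iso by (auto simp: dirac_isomorphic_def)
  have inj: "inj_on V K" and onto: "V ` K = K'"
    using V(1) by (auto simp: unitary_on_def bij_betw_def)
  have inv: "inv_into K V (V x) = x" if "x \<in> K" for x
    using inv_into_f_f[OF inj that] .
  show ?thesis
    unfolding dirac_isomorphic_def prod.case
    by (rule exI[of _ "inv_into K V"])
      (auto simp: unitary_on_inv_into[OF K V(1), folded onto] inv mem simp flip: onto V(2,3))
qed


section \<open>Structure of Dirac operators\<close>

locale dirac_space = clifford_space K R
  for K :: "'k::complex_inner set" and R :: "complex^'d::{finite,linorder} \<Rightarrow> 'k \<Rightarrow> 'k" +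
  fixes D :: "'k \<Rightarrow> 'k"
  assumes dirac: "dirac_operator K (D, R)"
begin

lemma D_self_adjoint: "self_adjoint_on K D"
  using dirac by (simp add: dirac_operator_def)

lemma D_mem [simp]: "x \<in> K \<Longrightarrow> D x \<in> K"
  and D_linear: "clinear_on K D"
  using D_self_adjoint by (auto simp: self_adjoint_on_def bounded_ops_def)

lemma D_simps:
  "x \<in> K \<Longrightarrow> D (s *\<^sub>C x) = s *\<^sub>C D x"
  "x \<in> K \<Longrightarrow> y \<in> K \<Longrightarrow> D (x + y) = D x + D y"
  "x \<in> K \<Longrightarrow> y \<in> K \<Longrightarrow> D (x - y) = D x - D y"
  "D 0 = 0"
  using D_linear clinear_on_diff[OF hilbert D_linear] clinear_on_zero[OF hilbert D_linear]
  by (auto simp: clinear_on_def)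

lemma cinner_D: "x \<in> K \<Longrightarrow> y \<in> K \<Longrightarrow> cinner (D x) y = cinner x (D y)"
  by (rule self_adjoint_on_cinner[OF hilbert D_self_adjoint])

lemma D_odd: "h \<in> vacuum \<Longrightarrow> gauge_group K R (-1) (D h) = - D h"
  using dirac adjoint_gauge_group_vacuum[of h "-1"] vacuum_mem[of h]
  unfolding dirac_operator_def prod.case by (metis norm_minus_cancel norm_one)

lemma D_square_gauge_invariant:
  "h \<in> vacuum \<Longrightarrow> cmod u = 1 \<Longrightarrow> gauge_group K R u (D (D h)) = D (D h)"
  using dirac adjoint_gauge_group_vacuum[of h u] vacuum_mem[of h]
  unfolding dirac_operator_def prod.case by metis

lemma anticommutator_commutes:
  assumes "x \<in> K"
  shows "R z (D (R w x)) + D (R z (R w x)) = R w (R z (D x) + D (R z x))"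
proof -
  have "R w \<in> cstar_generated K (range R)"
    by (auto simp: cstar_generated_def)
  moreover have "(\<lambda>x. R z (D x) + D (R z x)) \<in> commutant K (cstar_generated K (range R))"
    using dirac by (simp add: dirac_operator_def)
  ultimately show ?thesis
    using assms by (simp add: commutant_def)
qed

text \<open>For the Dirac operator of a tuple this anticommutator is
  \<open>T\<^sub>k \<otimes> 1\<close>: the part with \<open>T\<^sub>j\<close> leaves only the term
  \<open>j = k\<close>, and the part with the adjoints cancels. That is why it is the candidate for
  the tuple.\<close>

definition A :: "'d \<Rightarrow> 'k \<Rightarrow> 'k" where "A k x = a k (D x) + D (a k x)"
definition A_adj :: "'d \<Rightarrow> 'k \<Rightarrow> 'k" where "A_adj k x = c k (D x) + D (c k x)"

lemma A_mem [simp]: "x \<in> K \<Longrightarrow> A k x \<in> K" and A_adj_mem [simp]: "x \<in> K \<Longrightarrow> A_adj k x \<in> K"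
  by (simp_all add: A_def A_adj_def)

lemma A_linear: "clinear_on K (A k)" and A_adj_linear: "clinear_on K (A_adj k)"
  by (simp_all add: clinear_on_def A_def A_adj_def D_simps algebra_simps)

lemma cinner_A: "x \<in> K \<Longrightarrow> y \<in> K \<Longrightarrow> cinner (A k x) y = cinner x (A_adj k y)"
  by (simp add: A_def A_adj_def cinner_add_left cinner_add_right cinner_a cinner_D)

text \<open>Both operators are complex combinations of the anticommutators of \<open>D\<close> with
  \<open>R (axis k 1)\<close> and \<open>R (axis k \<i>)\<close>, which lie in the commutant by
  (D3).\<close>

lemma A_R: "x \<in> K \<Longrightarrow> A k (R w x) = R w (A k x)"
  and A_adj_R: "x \<in> K \<Longrightarrow> A_adj k (R w x) = R w (A_adj k x)"
proof -
  assume x: "x \<in> K"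
  define q where "q z x = R z (D x) + D (R z x)" for z x
  have q: "q z x \<in> K" "q z (R w x) = R w (q z x)" if "x \<in> K" for z w x
    using that anticommutator_commutes by (simp_all add: q_def R_mem)
  have "A k x = (1/2) *\<^sub>C (q (axis k 1) x + \<i> *\<^sub>C q (axis k \<i>) x)"
    "A_adj k x = (1/2) *\<^sub>C (q (axis k 1) x - \<i> *\<^sub>C q (axis k \<i>) x)" if "x \<in> K" for x
    using that by (simp_all add: A_def A_adj_def q_def annihilation_part_def creation_part_def
        imaginary_axis D_simps R_mem algebra_simps)
  then show "A k (R w x) = R w (A k x)" "A_adj k (R w x) = R w (A_adj k x)"
    using x by (simp_all add: R_mem R_simps q)
qed

lemma commutes_car:
  assumes X: "clinear_on K X" "\<And>x. x \<in> K \<Longrightarrow> X x \<in> K" "\<And>w x. x \<in> K \<Longrightarrow> X (R w x) = R w (X x)"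
    and x: "x \<in> K"
  shows "X (c j x) = c j (X x)" "X (a j x) = a j (X x)"
proof -
  have "X (s *\<^sub>C x) = s *\<^sub>C X x" "X (x + y) = X x + X y" "X (x - y) = X x - X y"
    if "x \<in> K" "y \<in> K" for s x y
    using X(1) clinear_on_diff[OF hilbert X(1)] that by (auto simp: clinear_on_def)
  then show "X (c j x) = c j (X x)" "X (a j x) = a j (X x)"
    using x by (simp_all add: creation_part_def annihilation_part_def X R_mem)
qed

lemmas A_car = commutes_car[OF A_linear A_mem A_R]
lemmas A_adj_car = commutes_car[OF A_adj_linear A_adj_mem A_adj_R]

lemma A_vacuum [simp]: "h \<in> vacuum \<Longrightarrow> A k h \<in> vacuum"
  and A_adj_vacuum [simp]: "h \<in> vacuum \<Longrightarrow> A_adj k h \<in> vacuum"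
  by (auto intro!: vacuumI simp: clinear_on_zero[OF hilbert A_linear]
      clinear_on_zero[OF hilbert A_adj_linear] simp flip: A_car A_adj_car)

text \<open>The difference of the two sides lies in the vacuum, where the gauge group acts trivially,
  but it is odd.\<close>

lemma D_vacuum:
  assumes h: "h \<in> vacuum"
  shows "D h = (\<Sum>k\<in>UNIV. c k (A k h))"
proof -
  define s where "s = (\<Sum>k\<in>UNIV. c k (A k h))"
  define y where "y = D h - s"
  have s: "s \<in> K"
    using h by (simp add: s_def)
  have "y \<in> vacuum"
  proof (rule vacuumI)
    fix j
    have "a j (c k (A k h)) = (if j = k then A k h else 0)" for k
      using h by (simp add: a_c)
    then have "a j s = A j h"
      using h by (simp add: s_def)
    moreover have "a j (D h) = A j h"
      using h by (simp add: A_def D_simps)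
    ultimately show "a j y = 0"
      using h s by (simp add: y_def)
  qed (use h s in \<open>simp add: y_def\<close>)
  moreover have "number_op K R s = of_nat 1 *\<^sub>C s"
    using h number_op_creation[of "A _ h" 0]
    by (simp add: s_def number_op_sum number_op_vacuum scaleC.scale_sum_right)
  ultimately have "gauge_group K R (-1) (y + s) = y - s"
    using gauge_group_vacuum_add[of y s 1 "-1"] s by simp
  then have "y - s = - (y + s)"
    using D_odd[OF h] by (simp add: y_def)
  then have "y = - y"
    by simp
  then have "y = 0"
    using real_vector_eq_minus_self by blast
  then show ?thesis
    by (simp add: y_def s_def)
qed

lemma D_creation: "x \<in> K \<Longrightarrow> D (c k x) = A_adj k x - c k (D x)"
  by (simp add: A_adj_def)

text \<open>On the vacuum the second sum vanishes. Along \<open>c j\<close> both sides obey the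
  recursion of \<open>D_creation\<close>: commuting \<open>c j\<close> out of the sums gives a minus
  sign and, from the term \<open>k = j\<close> of the second sum, \<open>A_adj j x\<close>.\<close>

lemma D_expand: "x \<in> K \<Longrightarrow> D x = (\<Sum>k\<in>UNIV. c k (A k x)) + (\<Sum>k\<in>UNIV. a k (A_adj k x))"
proof (induction rule: fock_induct)
  case (vacuum h)
  then show ?case by (simp add: D_vacuum)
next
  case (creation j x)
  have "a k (A_adj k (c j x)) = (if k = j then A_adj j x else 0) - c j (a k (A_adj k x))" for k
    using creation.hyps by (simp add: A_adj_car a_c)
  moreover have "c k (A k (c j x)) = - c j (c k (A k x))" for k
    using creation.hyps by (simp add: A_car c_c[of _ k j])
  ultimately show ?case
    using creation by (simp add: D_creation sum_subtractf sum_negf)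
next
  case (add x y)
  then show ?case
    using A_linear A_adj_linear by (simp add: D_simps clinear_on_def sum.distrib)
qed

text \<open>\<open>D\<^sup>2 h\<close> has components of degrees 0 and 2; the second one is multiplied by \<open>-1\<close> by the
  gauge group at \<open>\<i>\<close>, hence vanishes.\<close>

lemma A_commute:
  assumes h: "h \<in> vacuum"
  shows "A p (A q h) = A q (A p h)"
proof -
  define y where "y = (\<Sum>k\<in>UNIV. A_adj k (A k h))"
  define x where "x = (\<Sum>k\<in>UNIV. \<Sum>j\<in>UNIV. c k (c j (A j (A k h))))"
  have y: "y \<in> vacuum"
    unfolding y_def using h by (intro hilbert_space_sum[OF hilbert_space_vacuum]) simp
  have x: "x \<in> K"
    using h by (simp add: x_def)
  \<comment> \<open>\<open>D_vacuum\<close> is used twice, at \<open>h\<close> and at each vacuum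
    vector \<open>A k h\<close>, with \<open>D_creation\<close> in between.\<close>
  have DD: "D (D h) = y - x"
    using h by (simp add: D_vacuum clinear_on_sum[OF hilbert D_linear] D_creation sum_subtractf
        y_def x_def)
  have "number_op K R (c k (c j (A j (A k h)))) = of_nat 2 *\<^sub>C c k (c j (A j (A k h)))" for k j
    using h number_op_creation[of "A j (A k h)" 0 j] number_op_creation[of "c j (A j (A k h))" 1 k]
    by (simp add: number_op_vacuum)
  then have "number_op K R x = of_nat 2 *\<^sub>C x"
    using h by (simp add: x_def number_op_sum scaleC.scale_sum_right)
  then have "gauge_group K R \<i> (y - x) = y + x"
    using gauge_group_vacuum_add[of y "- x" 2 \<i>] x y number_op_scaleC[of x "-1"] by simp
  then have "x = - x"
    using D_square_gauge_invariant[OF h, of \<i>] by (simp add: DD eq_neg_iff_add_eq_0)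
  then have "x = 0"
    using real_vector_eq_minus_self by blast
  \<comment> \<open>The two annihilations read off the coefficient of \<open>p\<close> and
    \<open>q\<close>, to which the two orders of summation contribute with opposite signs.\<close>
  then have "0 = a q (a p x)"
    by simp
  also have "\<dots> = (\<Sum>k\<in>UNIV. \<Sum>j\<in>UNIV. a q (a p (c k (c j (A j (A k h))))))"
    using h by (simp add: x_def)
  also have "\<dots> = (\<Sum>k\<in>UNIV. \<Sum>j\<in>UNIV. (if p = k then if q = j then A j (A k h) else 0 else 0)
      - (if q = k then if p = j then A j (A k h) else 0 else 0))"
    using h by (intro sum.cong refl) (simp add: a_c)
  also have "\<dots> = A q (A p h) - A p (A q h)"
    by (simp add: sum_subtractf sum.If_cases if_distrib[of "sum _"] flip: sum.delta)
  finally show ?thesis by simp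
qed

lemma commuting_tuple_A: "commuting_tuple vacuum A"
proof -
  obtain M where M: "\<And>x. x \<in> K \<Longrightarrow> norm (D x) \<le> M * norm x"
    using D_self_adjoint by (auto simp: self_adjoint_on_def bounded_ops_def)
  \<comment> \<open>On the vacuum the term \<open>D (a k h)\<close> drops out, and
    \<open>a k\<close> is a contraction, so a bound of \<open>D\<close> serves for every
    \<open>A k\<close>.\<close>
  have "norm (A k h) \<le> M * norm h" if "h \<in> vacuum" for k h
    using norm_a_le[of "D h" k] M[of h] that by (simp add: A_def D_simps)
  then have "A k \<in> bounded_ops vacuum" for k
    using A_linear by (auto simp: bounded_ops_def clinear_on_def)
  then show ?thesis
    by (simp add: commuting_tuple_def A_commute)
qed

section \<open>Transport of \<open>D\<close> and \<open>R\<close> through the Fock map\<close>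

lemma fock_map_A:
  assumes "f \<in> tensor_space vacuum"
  shows "fock_map (\<chi> S. A k (f $ S)) = A k (fock_map f)"
proof -
  have "A k (foldr c xs h) = foldr c xs (A k h)" if "h \<in> K" for xs h
    using that by (induction xs) (simp_all add: A_car)
  then show ?thesis
    using assms by (simp add: fock_map_def monomial_def clinear_on_sum[OF hilbert A_linear])
qed

lemma fock_map_boundary_op:
  assumes f: "f \<in> tensor_space vacuum"
  shows "fock_map (boundary_op A f) = (\<Sum>k\<in>UNIV. c k (A k (fock_map f)))"
proof -
  have Af: "(\<chi> S. A k (f $ S)) \<in> tensor_space vacuum" for k
    unfolding tensor_space_def using f by simp
  have "fock_map (boundary_op A f) = (\<Sum>k\<in>UNIV. fock_map (tensor_create k (\<chi> S. A k (f $ S))))"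
    unfolding boundary_op_eq using Af
    by (intro clinear_on_sum[OF hilbert_space_tensor_space[OF hilbert_space_vacuum] fock_map_linear]
        tensor_create_mem[OF hilbert_space_vacuum])
  then show ?thesis
    using Af f by (simp add: fock_map_A flip: c_fock_map)
qed

text \<open>The adjoint is found in \<open>K\<close>, where moving \<open>c k\<close> and
  \<open>A k\<close> across the inner product is explicit, and is then pulled back by surjectivity
  and isometry of the Fock map.\<close>

lemma fock_map_adjoint_boundary_op:
  assumes f: "f \<in> tensor_space vacuum"
  shows "adjoint_on (tensor_space vacuum) (boundary_op A) f \<in> tensor_space vacuum"
    "fock_map (adjoint_on (tensor_space vacuum) (boundary_op A) f) =
      (\<Sum>k\<in>UNIV. a k (A_adj k (fock_map f)))"
proof -
  obtain g where g: "g \<in> tensor_space vacuum" "(\<Sum>k\<in>UNIV. a k (A_adj k (fock_map f))) = fock_map g"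
    by (rule fock_map_surj[of "\<Sum>k\<in>UNIV. a k (A_adj k (fock_map f))"])
      (use f in \<open>simp_all add: fock_map_mem\<close>)
  have "adjoint_on (tensor_space vacuum) (boundary_op A) f = g"
  proof (rule adjoint_on_eqI[OF hilbert_space_tensor_space[OF hilbert_space_vacuum] g(1)])
    fix f' :: "'k^('d set)" assume f': "f' \<in> tensor_space vacuum"
    then have "cinner (boundary_op A f') f = cinner (fock_map (boundary_op A f')) (fock_map f)"
      using f by (simp add: cinner_fock_map boundary_op_mem[OF hilbert_space_vacuum])
    also have "\<dots> = cinner (fock_map f') (\<Sum>k\<in>UNIV. a k (A_adj k (fock_map f)))"
      using f f' by (simp add: fock_map_boundary_op cinner_sum_left cinner_sum_right cinner_c
          cinner_A A_adj_car fock_map_mem)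
    also have "\<dots> = cinner f' g"
      using f' g by (simp add: cinner_fock_map)
    finally show "cinner (boundary_op A f') f = cinner f' g" .
  qed
  with g show "adjoint_on (tensor_space vacuum) (boundary_op A) f \<in> tensor_space vacuum"
    "fock_map (adjoint_on (tensor_space vacuum) (boundary_op A) f) =
      (\<Sum>k\<in>UNIV. a k (A_adj k (fock_map f)))" by simp_all
qed

lemma dirac_isomorphic_dirac_of_tuple:
  "dirac_isomorphic K (D, R) (tensor_space vacuum) (dirac_of_tuple vacuum A)"
proof -
  note tensor = hilbert_space_tensor_space[OF hilbert_space_vacuum]
  note linear = fock_map_linear[unfolded clinear_on_def]
  obtain D' R' where P: "dirac_of_tuple vacuum A = (D', R')"
    by fastforce
  have D': "D' f = boundary_op A f + adjoint_on (tensor_space vacuum) (boundary_op A) f"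
    and R': "R' z f =
      (\<Sum>k\<in>UNIV. z $ k *\<^sub>C tensor_create k f + cnj (z $ k) *\<^sub>C tensor_annihilate k f)" for f z
    using fst_dirac_of_tuple[of vacuum A f] dirac_of_tuple_clifford[of vacuum A z f]
    by (simp_all add: P)
  have mem: "D' f \<in> tensor_space vacuum" "R' z f \<in> tensor_space vacuum"
    if "f \<in> tensor_space vacuum" for f z
    unfolding D' R' using that
    by (auto intro!: hilbert_space_mem[OF tensor] boundary_op_mem[OF hilbert_space_vacuum]
        fock_map_adjoint_boundary_op tensor_create_mem[OF hilbert_space_vacuum]
        tensor_annihilate_mem[OF hilbert_space_vacuum])
  have "fock_map (D' f) = D (fock_map f)" if "f \<in> tensor_space vacuum" for f
    using that linear boundary_op_mem[OF hilbert_space_vacuum, of A f]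
    by (simp add: D' fock_map_adjoint_boundary_op fock_map_boundary_op fock_map_mem flip: D_expand)
  moreover have "fock_map (R' z f) = R z (fock_map f)" if f: "f \<in> tensor_space vacuum" for z f
  proof -
    have f': "tensor_create k f \<in> tensor_space vacuum" "tensor_annihilate k f \<in> tensor_space vacuum"
      for k
      using f by (simp_all add: tensor_create_mem tensor_annihilate_mem hilbert_space_vacuum)
    have "fock_map (R' z f) = (\<Sum>k\<in>UNIV. fock_map
        (z $ k *\<^sub>C tensor_create k f + cnj (z $ k) *\<^sub>C tensor_annihilate k f))"
      unfolding R' using f'
      by (intro clinear_on_sum[OF tensor fock_map_linear] hilbert_space_mem[OF tensor])
    also have "\<dots> = R z (fock_map f)"
      using f' linear f
      by (simp add: R_expand fock_map_mem c_fock_map a_fock_map hilbert_space_scaleC[OF tensor])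
    finally show ?thesis .
  qed
  ultimately have "dirac_isomorphic (tensor_space vacuum) (D', R') K (D, R)"
    unfolding dirac_isomorphic_def using unitary_fock_map by auto
  then show ?thesis
    unfolding P by (rule dirac_isomorphic_sym[OF tensor _ mem])
qed

end


section \<open>Vacuum vectors of a tensor product\<close>

text \<open>This is \<open>h\<close> tensored with the unit \<open>axis {} 1\<close> of the exterior
  algebra.\<close>

definition vacuum_vec :: "'a::complex_inner \<Rightarrow> 'a^('d::{finite,linorder} set)"
  where "vacuum_vec h = (\<chi> S. if S = {} then h else 0)"

lemma scaleC_vec_component: "(s *\<^sub>C x) $ i = s *\<^sub>C (x $ i)"
  by (simp add: scaleC_vec_def)

lemma vacuum_vec_nth_empty: "vacuum_vec h $ {} = h"
  by (simp add: vacuum_vec_def)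

lemma vacuum_vec_mem: "hilbert_space H \<Longrightarrow> h \<in> H \<Longrightarrow> vacuum_vec h \<in> tensor_space H"
  by (simp add: vacuum_vec_def tensor_space_def hilbert_space_zero)

lemma vacuum_vec_add: "vacuum_vec (x + y) = vacuum_vec x + vacuum_vec y"
  by (simp add: vec_eq_iff vacuum_vec_def)

lemma vacuum_vec_scaleC: "vacuum_vec (s *\<^sub>C x) = s *\<^sub>C vacuum_vec x"
  by (simp add: vec_eq_iff vacuum_vec_def scaleC_vec_def)

lemma vacuum_vec_inject: "vacuum_vec x = (vacuum_vec y :: 'a::complex_inner^('d::{finite,linorder} set)) \<longleftrightarrow> x = y"
  by (auto simp: vec_eq_iff vacuum_vec_def)

lemma cinner_vacuum_vec:
  "cinner (vacuum_vec x :: 'a::complex_inner^('d::{finite,linorder} set)) (vacuum_vec y) = cinner x y"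
proof -
  have "cinner (vacuum_vec x $ S) (vacuum_vec y $ S) = (if S = {} then cinner x y else 0)" for S :: "'d set"
    by (simp add: vacuum_vec_def)
  then show ?thesis
    by (simp add: cinner_vec_def)
qed

lemma tensor_annihilate_vacuum_vec: "tensor_annihilate k (vacuum_vec h) = 0"
  by (simp add: vec_eq_iff vacuum_vec_def tensor_annihilate_def)

text \<open>A nonempty \<open>S\<close> contains some \<open>k\<close>, and annihilating
  \<open>k\<close> moves the coordinate at \<open>S\<close>, up to sign, to
  \<open>S - {k}\<close>.\<close>

lemma vacuum_vecI:
  assumes "\<And>k. tensor_annihilate k f = 0"
  shows "f = vacuum_vec (f $ {})"
proof -
  have "f $ S = 0" if "S \<noteq> {}" for S
  proof -
    obtain k where k: "k \<in> S" using \<open>S \<noteq> {}\<close> by blast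
    then have "ext_sign (S - {k}) k *\<^sub>C f $ S = tensor_annihilate k f $ (S - {k})"
      by (simp add: tensor_annihilate_def insert_absorb)
    then show ?thesis
      using assms by (simp add: ext_sign_def)
  qed
  then show ?thesis
    by (simp add: vec_eq_iff vacuum_vec_def)
qed

text \<open>The \<open>k\<close>-th summand is supported at \<open>{k}\<close>, so annihilating
  \<open>j\<close> isolates one entry. This extracts a single operator of the tuple from the value
  of \<open>D\<close> at a vacuum vector.\<close>

lemma tensor_annihilate_create_vacuum_vec:
  fixes h :: "'d::{finite,linorder} \<Rightarrow> 'a::complex_inner"
  shows "tensor_annihilate j (\<Sum>k\<in>UNIV. tensor_create k (vacuum_vec (h k))) = vacuum_vec (h j)"
proof -
  have create: "tensor_create k (vacuum_vec v) $ U = (if U = {k} then v else 0)"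
    for k and v :: 'a and U :: "'d set"
  proof (cases "U = {k}")
    case True
    moreover have "{t. t = k \<and> t < k} = {}" by auto
    ultimately show ?thesis
      by (simp add: tensor_create_def vacuum_vec_def ext_sign_def del: Collect_empty_eq)
  next
    case False
    then have "k \<in> U \<Longrightarrow> U - {k} \<noteq> {}" by blast
    then show ?thesis
      using False by (simp add: tensor_create_def vacuum_vec_def)
  qed
  have sum: "(\<Sum>k\<in>UNIV. tensor_create k (vacuum_vec (h k))) $ (insert j U) =
      (if U = {} then h j else 0)" if "j \<notin> U" for U
  proof -
    have "insert j U = {k} \<longleftrightarrow> U = {} \<and> k = j" for k
      using that by auto
    then show ?thesis
      by (simp add: create)
  qed
  have "vacuum_vec (h j) $ U = (if U = {} then h j else 0)" for U :: "'d set"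
    by (simp add: vacuum_vec_def)
  then show ?thesis
    unfolding vec_eq_iff tensor_annihilate_def vec_lambda_beta
    by (auto simp: sum ext_sign_def simp del: sum_component)
qed

text \<open>The adjoint of the boundary operator kills vacuum vectors, since creations pass across
  the inner product as annihilations.\<close>

lemma dirac_of_tuple_vacuum_vec:
  fixes T :: "'d::{finite,linorder} \<Rightarrow> 'a::complex_inner \<Rightarrow> 'a"
  assumes H: "hilbert_space H" and T: "\<And>k. clinear_on H (T k)"
  shows "fst (dirac_of_tuple H T) (vacuum_vec h) = (\<Sum>k\<in>UNIV. tensor_create k (vacuum_vec (T k h)))"
proof -
  have "adjoint_on (tensor_space H) (boundary_op T) (vacuum_vec h) = 0"
    by (rule adjoint_on_eqI[OF hilbert_space_tensor_space[OF H]])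
      (simp_all add: hilbert_space_zero[OF hilbert_space_tensor_space[OF H]] boundary_op_eq
        cinner_sum_left cinner_tensor_create tensor_annihilate_vacuum_vec)
  moreover have "(\<chi> S. T k (vacuum_vec h $ S)) = (vacuum_vec (T k h) :: 'a^('d set))" for k
    using clinear_on_zero[OF H T] by (simp add: vec_eq_iff vacuum_vec_def)
  ultimately show ?thesis
    by (simp add: fst_dirac_of_tuple boundary_op_eq)
qed

text \<open>Expresses annihilation through the Clifford part alone, so that isomorphisms intertwine
  it.\<close>

lemma annihilation_part_dirac_of_tuple:
  "annihilation_part (snd (dirac_of_tuple H T)) (axis k 1) f = tensor_annihilate k f"
proof -
  have "snd (dirac_of_tuple H T) (axis k w) f = w *\<^sub>C tensor_create k f + cnj w *\<^sub>C tensor_annihilate k f" for w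
  proof -
    have "axis k w $ j *\<^sub>C tensor_create j f + cnj (axis k w $ j) *\<^sub>C tensor_annihilate j f =
      (if j = k then w *\<^sub>C tensor_create k f + cnj w *\<^sub>C tensor_annihilate k f else 0)" for j
      by (simp add: axis_def)
    then show ?thesis
      by (simp add: dirac_of_tuple_clifford)
  qed
  then show ?thesis
    by (simp add: annihilation_part_def imaginary_axis scaleC.scale_right_distrib
        scaleC.scale_right_diff_distrib scaleC_half_double)
qed


section \<open>Isomorphism of Dirac operators and unitary equivalence of tuples\<close>

lemma unitary_equivalent_of_dirac_isomorphic:
  fixes H :: "'h::complex_inner set" and H' :: "'h'::complex_inner set"
    and T :: "'d::{finite,linorder} \<Rightarrow> 'h \<Rightarrow> 'h"
  assumes H: "hilbert_space H" and H': "hilbert_space H'"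
    and T: "commuting_tuple H T" and T': "commuting_tuple H' T'"
    and iso: "dirac_isomorphic (tensor_space H) (dirac_of_tuple H T)
      (tensor_space H') (dirac_of_tuple H' T')"
  shows "\<exists>U. unitary_on H H' U \<and> (\<forall>k. \<forall>x\<in>H. U (T k x) = T' k (U x))"
proof -
  note tensor = hilbert_space_tensor_space[OF H] and tensor' = hilbert_space_tensor_space[OF H']
  let ?D = "fst (dirac_of_tuple H T)" and ?D' = "fst (dirac_of_tuple H' T')"
  let ?R = "snd (dirac_of_tuple H T)" and ?R' = "snd (dirac_of_tuple H' T')"
  obtain W where W: "unitary_on (tensor_space H) (tensor_space H') W"
    and WD: "\<And>f. f \<in> tensor_space H \<Longrightarrow> W (?D f) = ?D' (W f)"
    and WR: "\<And>z f. f \<in> tensor_space H \<Longrightarrow> W (?R z f) = ?R' z (W f)"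
    using iso by (auto simp: dirac_isomorphic_def split: prod.splits)
  have lin: "clinear_on (tensor_space H) W" and bij: "bij_betw W (tensor_space H) (tensor_space H')"
    and iso: "\<And>f g. f \<in> tensor_space H \<Longrightarrow> g \<in> tensor_space H \<Longrightarrow> cinner (W f) (W g) = cinner f g"
    using W by (auto simp: unitary_on_def)
  have W_mem: "W f \<in> tensor_space H'" if "f \<in> tensor_space H" for f
    using bij that by (auto simp: bij_betw_def)
  have T_mem: "T k x \<in> H" if "x \<in> H" for k x
    using T that by (auto simp: commuting_tuple_def bounded_ops_def)
  have T_lin: "clinear_on H (T k)" and T'_lin: "clinear_on H' (T' k)" for k
    using T T' by (auto simp: commuting_tuple_def bounded_ops_def)
  have W_ann: "W (tensor_annihilate k f) = tensor_annihilate k (W f)" if f: "f \<in> tensor_space H" for k f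
  proof -
    have "?R z f \<in> tensor_space H" for z
      unfolding dirac_of_tuple_clifford using f
      by (intro hilbert_space_mem[OF tensor] tensor_create_mem tensor_annihilate_mem H)
    then have "W (annihilation_part ?R z f) = annihilation_part ?R' z (W f)" for z
      using lin f unfolding annihilation_part_def clinear_on_def
      by (simp add: hilbert_space_mem[OF tensor] flip: WR)
    then show ?thesis
      by (metis annihilation_part_dirac_of_tuple)
  qed
  have W0: "W 0 = 0"
    by (rule clinear_on_zero[OF tensor lin])
  define U where "U h = W (vacuum_vec h) $ {}" for h
  have U_mem: "U h \<in> H'" and W_vac: "W (vacuum_vec h) = vacuum_vec (U h)" if "h \<in> H" for h
  proof -
    have h: "(vacuum_vec h :: 'h^('d set)) \<in> tensor_space H"
      by (rule vacuum_vec_mem[OF H that])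
    show "U h \<in> H'"
      using W_mem[OF h] by (simp add: U_def tensor_space_def)
    show "W (vacuum_vec h) = vacuum_vec (U h)"
      unfolding U_def by (rule vacuum_vecI)
        (simp add: W_ann[OF h, symmetric] tensor_annihilate_vacuum_vec W0)
  qed
  have "inj_on U H"
  proof (rule inj_onI)
    fix x y assume x: "x \<in> H" and y: "y \<in> H" and "U x = U y"
    then have "W (vacuum_vec x) = W (vacuum_vec y)"
      by (simp add: W_vac)
    then have "(vacuum_vec x :: 'h^('d set)) = vacuum_vec y"
      using bij vacuum_vec_mem[OF H x] vacuum_vec_mem[OF H y] by (meson bij_betw_def inj_onD)
    then show "x = y"
      by (simp only: vacuum_vec_inject)
  qed
  moreover have "U ` H = H'"
  proof (intro equalityI subsetI)
    fix y assume y: "y \<in> H'"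
    then obtain f where f: "f \<in> tensor_space H" "W f = vacuum_vec y"
      using bij vacuum_vec_mem[OF H' y] by (metis bij_betw_imp_surj_on imageE)
    \<comment> \<open>Injectivity of \<open>W\<close> carries the vacuum property of
      \<open>W f\<close> back to \<open>f\<close>; this makes \<open>U\<close> surjective.\<close>
    have "tensor_annihilate k f = 0" for k
    proof -
      have "W (tensor_annihilate k f) = W 0"
        using f by (simp add: W_ann W0 tensor_annihilate_vacuum_vec)
      then show ?thesis
        using bij tensor_annihilate_mem[OF H f(1)] hilbert_space_zero[OF tensor]
        by (meson bij_betw_def inj_onD)
    qed
    then have "f = vacuum_vec (f $ {})"
      by (rule vacuum_vecI)
    then have "W (vacuum_vec (f $ {})) = vacuum_vec y"
      using f(2) by metis
    then have "y = U (f $ {})"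
      by (simp add: U_def vacuum_vec_nth_empty)
    moreover have "f $ {} \<in> H"
      using f(1) by (simp add: tensor_space_def)
    ultimately show "y \<in> U ` H" by blast
  qed (use U_mem in auto)
  moreover have "clinear_on H U"
    using lin vacuum_vec_mem[OF H, where ?'b = 'd]
    by (simp add: clinear_on_def U_def vacuum_vec_add vacuum_vec_scaleC scaleC_vec_component)
  moreover have "cinner (U x) (U y) = cinner x y" if "x \<in> H" "y \<in> H" for x y
  proof -
    have "cinner (U x) (U y) = cinner (W (vacuum_vec x)) (W (vacuum_vec y))"
      using that by (simp add: W_vac cinner_vacuum_vec)
    also have "\<dots> = cinner (vacuum_vec x :: 'h^('d set)) (vacuum_vec y)"
      using that by (intro iso vacuum_vec_mem H)
    finally show ?thesis
      by (simp add: cinner_vacuum_vec)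
  qed
  ultimately have "unitary_on H H' U"
    by (simp add: unitary_on_def bij_betw_def)
  moreover have "U (T k h) = T' k (U h)" if h: "h \<in> H" for k h
  proof -
    have mem: "(vacuum_vec h :: 'h^('d set)) \<in> tensor_space H"
      by (rule vacuum_vec_mem[OF H h])
    have D_mem: "?D (vacuum_vec h) \<in> tensor_space H"
      unfolding dirac_of_tuple_vacuum_vec[OF H T_lin] using h
      by (intro hilbert_space_sum[OF tensor] tensor_create_mem vacuum_vec_mem H T_mem)
    have "vacuum_vec (U (T k h)) = W (vacuum_vec (T k h))"
      using W_vac[OF T_mem[OF h]] by simp
    also have "\<dots> = W (tensor_annihilate k (?D (vacuum_vec h)))"
      by (simp only: dirac_of_tuple_vacuum_vec[OF H T_lin] tensor_annihilate_create_vacuum_vec)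
    also have "\<dots> = tensor_annihilate k (?D' (vacuum_vec (U h)))"
      using h by (simp add: W_ann[OF D_mem] WD[OF mem] W_vac)
    also have "\<dots> = vacuum_vec (T' k (U h))"
      by (simp only: dirac_of_tuple_vacuum_vec[OF H' T'_lin] tensor_annihilate_create_vacuum_vec)
    finally show ?thesis
      by (simp only: vacuum_vec_inject)
  qed
  ultimately show ?thesis by blast
qed

text \<open>The adjoint is the sum of
  \<open>T\<^sub>k\<^sup>* \<otimes> C\<^sub>0(e\<^sub>k)\<^sup>*\<close>, where the adjoints on
  \<open>H\<close> exist by the Riesz representation.\<close>

lemma adjoint_boundary_op:
  assumes H: "hilbert_space H" and T: "\<And>k. T k \<in> bounded_ops H" and f: "f \<in> tensor_space H"
  shows "adjoint_on (tensor_space H) (boundary_op T) f \<in> tensor_space H" (is ?mem)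
    "g \<in> tensor_space H \<Longrightarrow>
      cinner (boundary_op T g) f = cinner g (adjoint_on (tensor_space H) (boundary_op T) f)"
proof -
  define v where "v = (\<Sum>k\<in>UNIV. \<chi> S. adjoint_on H (T k) (tensor_annihilate k f $ S))"
  have f': "tensor_annihilate k f $ S \<in> H" for k S
    using tensor_annihilate_mem[OF H f] by (simp add: tensor_space_def)
  have v: "v \<in> tensor_space H"
    unfolding v_def using adjoint_on_bounded_op(1)[OF H T f']
    by (intro hilbert_space_sum[OF hilbert_space_tensor_space[OF H]]) (simp add: tensor_space_def)
  have adj: "cinner (boundary_op T g) f = cinner g v" if g: "g \<in> tensor_space H" for g
  proof -
    have "cinner (\<chi> S. T k (g $ S)) (tensor_annihilate k f) =
        cinner g (\<chi> S. adjoint_on H (T k) (tensor_annihilate k f $ S))" for k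
      using g f' by (simp add: cinner_vec_def tensor_space_def adjoint_on_bounded_op(2)[OF H T])
    then show ?thesis
      by (simp add: boundary_op_eq v_def cinner_sum_left cinner_sum_right cinner_tensor_create)
  qed
  then have "adjoint_on (tensor_space H) (boundary_op T) f = v"
    using v by (intro adjoint_on_eqI[OF hilbert_space_tensor_space[OF H]])
  with v adj show ?mem "g \<in> tensor_space H \<Longrightarrow>
      cinner (boundary_op T g) f = cinner g (adjoint_on (tensor_space H) (boundary_op T) f)"
    by simp_all
qed

text \<open>An adjoint vector is carried along \<open>W\<close>; surjectivity of \<open>W\<close>
  lets the images of \<open>K\<close> serve as test vectors.\<close>

lemma adjoint_on_unitary:
  assumes K': "hilbert_space K'" and W: "unitary_on K K' W"
    and X: "\<And>x. x \<in> K \<Longrightarrow> X x \<in> K" "\<And>x. x \<in> K \<Longrightarrow> W (X x) = X' (W x)"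
    and y: "y \<in> K" and v: "v \<in> K" "\<And>x. x \<in> K \<Longrightarrow> cinner (X x) y = cinner x v"
  shows "adjoint_on K' X' (W y) = W v"
proof (rule adjoint_on_eqI[OF K'])
  have onto: "K' = W ` K" and iso: "\<And>x y. x \<in> K \<Longrightarrow> y \<in> K \<Longrightarrow> cinner (W x) (W y) = cinner x y"
    using W by (auto simp: unitary_on_def bij_betw_def)
  show "W v \<in> K'"
    using v(1) onto by blast
  fix x' assume "x' \<in> K'"
  then obtain x where x: "x \<in> K" "x' = W x"
    using onto by blast
  have "cinner (X' (W x)) (W y) = cinner (W (X x)) (W y)"
    using x(1) by (simp add: X)
  then show "cinner (X' x') (W y) = cinner x' (W v)"
    using x y v X(1) by (simp add: iso)
qed

lemma dirac_isomorphic_of_unitary_equivalent: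
  fixes H :: "'h::complex_inner set" and H' :: "'h'::complex_inner set"
    and T :: "'d::{finite,linorder} \<Rightarrow> 'h \<Rightarrow> 'h"
  assumes H: "hilbert_space H" and H': "hilbert_space H'" and T: "commuting_tuple H T"
    and U: "unitary_on H H' U" and UT: "\<And>k x. x \<in> H \<Longrightarrow> U (T k x) = T' k (U x)"
  shows "dirac_isomorphic (tensor_space H) (dirac_of_tuple H T)
      (tensor_space H') (dirac_of_tuple H' T')"
proof -
  note tensor = hilbert_space_tensor_space[OF H] and tensor' = hilbert_space_tensor_space[OF H']
  have lin: "clinear_on H U" and inj: "inj_on U H" and onto: "U ` H = H'"
    and iso: "\<And>x y. x \<in> H \<Longrightarrow> y \<in> H \<Longrightarrow> cinner (U x) (U y) = cinner x y"
    using U by (auto simp: unitary_on_def bij_betw_def)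
  have U0: "U 0 = 0"
    by (rule clinear_on_zero[OF H lin])
  have T_bounded: "T k \<in> bounded_ops H" for k
    using T by (simp add: commuting_tuple_def)
  then have T_mem: "T k x \<in> H" if "x \<in> H" for k x
    using that by (simp add: bounded_ops_def)
  \<comment> \<open>This is \<open>U\<close> tensored with the identity of the exterior
    algebra.\<close>
  define W :: "'h^('d set) \<Rightarrow> 'h'^('d set)" where "W f = (\<chi> S. U (f $ S))" for f
  have f_mem: "f $ S \<in> H" if "f \<in> tensor_space H" for f :: "'h^('d set)" and S
    using that by (simp add: tensor_space_def)
  have W_lin: "clinear_on (tensor_space H) W"
    using lin f_mem by (simp add: clinear_on_def W_def vec_eq_iff scaleC_vec_def)
  have W: "unitary_on (tensor_space H) (tensor_space H') W"
    unfolding unitary_on_def bij_betw_def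
  proof (intro conjI ballI W_lin)
    show "inj_on W (tensor_space H)"
      using inj f_mem by (auto simp: inj_on_def W_def vec_eq_iff)
    have "g \<in> W ` tensor_space H" if g: "g \<in> tensor_space H'" for g
    proof
      have "g $ S \<in> U ` H" for S
        using g by (simp add: onto tensor_space_def)
      then show "g = W (\<chi> S. inv_into H U (g $ S))" "(\<chi> S. inv_into H U (g $ S)) \<in> tensor_space H"
        by (simp_all add: W_def vec_eq_iff f_inv_into_f tensor_space_def inv_into_into)
    qed
    moreover have "W f \<in> tensor_space H'" if "f \<in> tensor_space H" for f
      using that onto by (auto simp: W_def tensor_space_def)
    ultimately show "W ` tensor_space H = tensor_space H'" by blast
  qed (simp add: cinner_vec_def W_def iso f_mem)
  have W_create: "W (tensor_create k f) = tensor_create k (W f)"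
    and W_ann: "W (tensor_annihilate k f) = tensor_annihilate k (W f)" if "f \<in> tensor_space H" for k f
    using lin f_mem[OF that]
    by (simp_all add: W_def vec_eq_iff tensor_create_def tensor_annihilate_def U0 clinear_on_def)
  have W_boundary: "W (boundary_op T f) = boundary_op T' (W f)" if f: "f \<in> tensor_space H" for f
  proof -
    have Tf: "(\<chi> S. T k (f $ S)) \<in> tensor_space H" for k
      using f_mem[OF f] T_mem by (simp add: tensor_space_def)
    have "W (\<chi> S. T k (f $ S)) = (\<chi> S. T' k (W f $ S))" for k
      using f_mem[OF f] by (simp add: W_def UT)
    then show ?thesis
      unfolding boundary_op_eq
      using Tf by (simp add: clinear_on_sum[OF tensor W_lin] tensor_create_mem[OF H] W_create)
  qed
  have boundary_mem: "boundary_op T f \<in> tensor_space H" if "f \<in> tensor_space H" for f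
    by (rule boundary_op_mem[OF H T_mem that])
  have "W (fst (dirac_of_tuple H T) f) = fst (dirac_of_tuple H' T') (W f)"
    if f: "f \<in> tensor_space H" for f
  proof -
    have "adjoint_on (tensor_space H') (boundary_op T') (W f) =
        W (adjoint_on (tensor_space H) (boundary_op T) f)"
      by (rule adjoint_on_unitary[OF tensor' W boundary_mem W_boundary f
          adjoint_boundary_op[OF H T_bounded f]])
    then show ?thesis
      using W_lin boundary_mem[OF f] adjoint_boundary_op(1)[OF H T_bounded f]
      by (simp add: fst_dirac_of_tuple clinear_on_def W_boundary[OF f])
  qed
  moreover have "W (snd (dirac_of_tuple H T) z f) = snd (dirac_of_tuple H' T') z (W f)"
    if f: "f \<in> tensor_space H" for z f
  proof -
    have mem: "tensor_create k f \<in> tensor_space H" "tensor_annihilate k f \<in> tensor_space H" for k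
      using f by (simp_all add: tensor_create_mem[OF H] tensor_annihilate_mem[OF H])
    have "W (snd (dirac_of_tuple H T) z f) =
        (\<Sum>k\<in>UNIV. W (z $ k *\<^sub>C tensor_create k f + cnj (z $ k) *\<^sub>C tensor_annihilate k f))"
      unfolding dirac_of_tuple_clifford using mem
      by (intro clinear_on_sum[OF tensor W_lin] hilbert_space_mem[OF tensor])
    also have "\<dots> = snd (dirac_of_tuple H' T') z (W f)"
      using mem W_lin
      by (simp add: dirac_of_tuple_clifford clinear_on_def hilbert_space_scaleC[OF tensor]
          W_create[OF f] W_ann[OF f])
    finally show ?thesis .
  qed
  ultimately show ?thesis
    using W by (auto simp: dirac_isomorphic_def split: prod.splits)
qed

theorem theoremA:
  shows
   "(\<forall>(K :: 'k::complex_inner set) (P :: ('k, 'd::{finite,linorder}) dirac_pair).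
      dirac_operator K P \<longrightarrow>
      (\<exists>(H :: 'k set) (T :: 'd \<Rightarrow> 'k \<Rightarrow> 'k).
        hilbert_space H \<and> commuting_tuple H T \<and>
        dirac_isomorphic K P (tensor_space H) (dirac_of_tuple H T))) \<and>
    (\<forall>(H :: 'h::complex_inner set) (T :: 'd \<Rightarrow> 'h \<Rightarrow> 'h)
      (H' :: 'h'::complex_inner set) (T' :: 'd \<Rightarrow> 'h' \<Rightarrow> 'h').
      hilbert_space H \<and> commuting_tuple H T \<and> hilbert_space H' \<and> commuting_tuple H' T' \<longrightarrow>
      (dirac_isomorphic (tensor_space H) (dirac_of_tuple H T)
         (tensor_space H') (dirac_of_tuple H' T') \<longleftrightarrow>
       (\<exists>U. unitary_on H H' U \<and> (\<forall>k. \<forall>x\<in>H. U (T k x) = T' k (U x)))))"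
proof (intro conjI allI impI)
  fix K :: "'k set" and P :: "('k, 'd) dirac_pair"
  assume P: "dirac_operator K P"
  obtain D R where [simp]: "P = (D, R)"
    by fastforce
  interpret dirac_space K R D
    using P by unfold_locales (simp_all add: dirac_operator_def)
  show "\<exists>(H :: 'k set) T. hilbert_space H \<and> commuting_tuple H T \<and>
      dirac_isomorphic K P (tensor_space H) (dirac_of_tuple H T)"
    using hilbert_space_vacuum commuting_tuple_A dirac_isomorphic_dirac_of_tuple by auto
next
  fix H :: "'h set" and T :: "'d \<Rightarrow> 'h \<Rightarrow> 'h" and H' :: "'h' set" and T' :: "'d \<Rightarrow> 'h' \<Rightarrow> 'h'"
  assume "hilbert_space H \<and> commuting_tuple H T \<and> hilbert_space H' \<and> commuting_tuple H' T'"
  then show "dirac_isomorphic (tensor_space H) (dirac_of_tuple H T)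
      (tensor_space H') (dirac_of_tuple H' T') \<longleftrightarrow>
    (\<exists>U. unitary_on H H' U \<and> (\<forall>k. \<forall>x\<in>H. U (T k x) = T' k (U x)))"
    using unitary_equivalent_of_dirac_isomorphic[of H H' T T']
      dirac_isomorphic_of_unitary_equivalent[of H H' T _ T'] by blast
qed

end
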